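(* Let $n\ge3$ and let $(M^n,g)$ be a strictly convex spacelike hypersurface in Minkowski space $\mathbb{R}^{n,1}$ with induced metric $g$. Then for all $1\le k\le n$, $\sigma_k(\kappa[M])$ is an intrinsic geometric quantity, i.e. it is determined by the metric $g$: if $(M,g)$ and $(M',g')$ are two strictly convex spacelike hypersurfaces in $\mathbb{R}^{n,1}$ and $\phi:U\to U'$ is an isometry between open sets $U\subset M$ and $U'\subset M'$, then $\sigma_k(\kappa[M])(p)=\sigma_k(\kappa[M'])(\phi(p))$ for all $p\in U$ and all $1\le k\le n$.
   Context: Minkowski space $\mathbb{R}^{n,1}$ is $\mathbb{R}^{n+1}$ with $\langle X,Y\rangle=\sum_{i=1}^n x_iy_i-x_{n+1}y_{n+1}$. A smooth hypersurface is spacelike if its induced metric $g$ is Riemannian; $\nu$ is its future directed unit normal (i.e. with positive $(n+1)$-th component and $\langle\nu,\nu\rangle=-1$). The second fundamental form is $h_{ij}=-\langle\nabla_i\nabla_jX,\nu\rangle$, and the principal curvatures $\kappa[M]=(\kappa_1,\dots,\kappa_n)$ are the eigenvalues of $h$ with respect to $g$; strictly convex means all $\kappa_i>0$. $\sigma_k$ is the $k$-th elementary symmetric polynomial. *)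

theory Defs
  imports "HOL-Analysis.Analysis" "HOL-Computational_Algebra.Polynomial"
begin

text \<open>Minkowski space \<open>R^{n,1}\<close> is the type \<open>real^'n \<times> real\<close> with \<open>n = CARD('n)\<close>; the
  second component is the time coordinate \<open>x_{n+1}\<close>.\<close>

type_synonym 'n minkowski = "(real^'n) \<times> real"

definition mink :: "'n::finite minkowski \<Rightarrow> 'n minkowski \<Rightarrow> real" where
  "mink X Y = (\<Sum>i\<in>UNIV. fst X $ i * fst Y $ i) - snd X * snd Y"


section \<open>Smooth functions on open subsets of Euclidean space\<close>

definition partial_deriv ::
  "'n::finite \<Rightarrow> (real^'n \<Rightarrow> 'b::real_normed_vector) \<Rightarrow> real^'n \<Rightarrow> 'b" where
  "partial_deriv i f u = frechet_derivative f (at u) (axis i 1)"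

text \<open>\<open>Ck_on k W f\<close>: \<open>f\<close> is of class \<open>C^k\<close> on the set \<open>W\<close>, to be used for open \<open>W\<close> only.\<close>

primrec Ck_on ::
  "nat \<Rightarrow> (real^'n::finite) set \<Rightarrow> (real^'n \<Rightarrow> 'b::real_normed_vector) \<Rightarrow> bool" where
  "Ck_on 0 W f \<longleftrightarrow> continuous_on W f"
| "Ck_on (Suc k) W f \<longleftrightarrow>
     (\<forall>u\<in>W. f differentiable (at u)) \<and> (\<forall>i. Ck_on k W (partial_deriv i f))"

definition smooth_on ::
  "(real^'n::finite) set \<Rightarrow> (real^'n \<Rightarrow> 'b::real_normed_vector) \<Rightarrow> bool" where
  "smooth_on W f \<longleftrightarrow> (\<forall>k. Ck_on k W f)"


section \<open>Hypersurfaces\<close>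

text \<open>A local parametrization of \<open>M\<close>: a smooth immersion of an open \<open>W \<subseteq> R^n\<close> which is a
  homeomorphism onto a relatively open subset of \<open>M\<close>.\<close>

definition local_param ::
  "'n::finite minkowski set \<Rightarrow> (real^'n) set \<Rightarrow> (real^'n \<Rightarrow> 'n minkowski) \<Rightarrow> bool" where
  "local_param M W x \<longleftrightarrow>
     open W \<and> smooth_on W x \<and> (\<forall>u\<in>W. inj (frechet_derivative x (at u))) \<and>
     openin (top_of_set M) (x ` W) \<and> (\<exists>y. homeomorphism W (x ` W) x y)"

definition smooth_hypersurface :: "'n::finite minkowski set \<Rightarrow> bool" where
  "smooth_hypersurface M \<longleftrightarrow> (\<forall>p\<in>M. \<exists>W x. local_param M W x \<and> p \<in> x ` W)"

definition tangent_space :: "'n::finite minkowski set \<Rightarrow> 'n minkowski \<Rightarrow> 'n minkowski set" where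
  "tangent_space M p =
     {v. \<exists>W x u. local_param M W x \<and> u \<in> W \<and> x u = p \<and> v \<in> range (frechet_derivative x (at u))}"

text \<open>The induced metric at \<open>p\<close> is the restriction of \<open>mink\<close> to the tangent space.\<close>

definition spacelike :: "'n::finite minkowski set \<Rightarrow> bool" where
  "spacelike M \<longleftrightarrow> (\<forall>p\<in>M. \<forall>v\<in>tangent_space M p. v \<noteq> 0 \<longrightarrow> mink v v > 0)"

definition unit_normal :: "'n::finite minkowski set \<Rightarrow> 'n minkowski \<Rightarrow> 'n minkowski" where
  "unit_normal M p =
     (THE \<nu>. (\<forall>v\<in>tangent_space M p. mink \<nu> v = 0) \<and> mink \<nu> \<nu> = -1 \<and> snd \<nu> > 0)"


section \<open>Fundamental forms in a local parametrization\<close>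

definition first_ff :: "(real^'n::finite \<Rightarrow> 'n minkowski) \<Rightarrow> real^'n \<Rightarrow> real^'n^'n" where
  "first_ff x u = (\<chi> i j. mink (partial_deriv i x u) (partial_deriv j x u))"

text \<open>\<open>christoffel x u k i j\<close> is the symbol with upper index \<open>k\<close> and lower indices \<open>i, j\<close> of the
  Levi-Civita connection of the induced metric.\<close>

definition christoffel ::
  "(real^'n::finite \<Rightarrow> 'n minkowski) \<Rightarrow> real^'n \<Rightarrow> 'n \<Rightarrow> 'n \<Rightarrow> 'n \<Rightarrow> real" where
  "christoffel x u k i j =
     (\<Sum>l\<in>UNIV. matrix_inv (first_ff x u) $ k $ l *
        (partial_deriv i (\<lambda>w. first_ff x w $ j $ l) u
         + partial_deriv j (\<lambda>w. first_ff x w $ i $ l) u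
         - partial_deriv l (\<lambda>w. first_ff x w $ i $ j) u)) / 2"

text \<open>The second covariant derivative \<open>\<nabla>_i \<nabla>_j X\<close> of the position vector \<open>X\<close>.\<close>

definition cov_hessian ::
  "(real^'n::finite \<Rightarrow> 'n minkowski) \<Rightarrow> real^'n \<Rightarrow> 'n \<Rightarrow> 'n \<Rightarrow> 'n minkowski" where
  "cov_hessian x u i j =
     partial_deriv i (partial_deriv j x) u
     - (\<Sum>k\<in>UNIV. christoffel x u k i j *\<^sub>R partial_deriv k x u)"

definition second_ff ::
  "'n::finite minkowski set \<Rightarrow> (real^'n \<Rightarrow> 'n minkowski) \<Rightarrow> real^'n \<Rightarrow> real^'n^'n" where
  "second_ff M x u = (\<chi> i j. - mink (cov_hessian x u i j) (unit_normal M (x u)))"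


section \<open>Principal curvatures\<close>

text \<open>Eigenvalues of \<open>h\<close> with respect to \<open>g\<close>, i.e. the zeros of \<open>det (h - \<lambda> g)\<close>, repeated
  according to multiplicity and listed in increasing order.\<close>

definition rel_eigenvalues :: "real^'n^'n::finite \<Rightarrow> real^'n^'n \<Rightarrow> real list" where
  "rel_eigenvalues h g =
     sorted_list_of_multiset (proots (det (\<chi> i j. [: h $ i $ j, - (g $ i $ j) :])))"

text \<open>The eigenvalues do not depend on the local parametrization around \<open>p\<close>, so that on a spacelike
  hypersurface the description below is unique.\<close>

definition principal_curvatures ::
  "'n::finite minkowski set \<Rightarrow> 'n minkowski \<Rightarrow> real list" where
  "principal_curvatures M p =
     (THE \<kappa>. \<exists>W x u. local_param M W x \<and> u \<in> W \<and> x u = p \<and>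
                \<kappa> = rel_eigenvalues (second_ff M x u) (first_ff x u))"

definition strictly_convex :: "'n::finite minkowski set \<Rightarrow> bool" where
  "strictly_convex M \<longleftrightarrow> (\<forall>p\<in>M. \<forall>\<kappa>\<in>set (principal_curvatures M p). \<kappa> > 0)"

definition sigma :: "nat \<Rightarrow> real list \<Rightarrow> real" where
  "sigma k \<kappa> = (\<Sum>I | I \<subseteq> {..<length \<kappa>} \<and> card I = k. \<Prod>i\<in>I. \<kappa> ! i)"


section \<open>Isometries between open subsets of hypersurfaces\<close>

text \<open>In the following two definitions \<open>U\<close> and \<open>U'\<close> are themselves hypersurfaces, such as open
  subsets of given ones. Since they are embedded, smoothness of a map into \<open>U'\<close> amounts to
  smoothness as a map into the ambient space.\<close>

definition smooth_map ::
  "'n::finite minkowski set \<Rightarrow> ('n minkowski \<Rightarrow> 'n minkowski) \<Rightarrow> bool" where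
  "smooth_map U \<phi> \<longleftrightarrow> (\<forall>W x. local_param U W x \<longrightarrow> smooth_on W (\<phi> \<circ> x))"

text \<open>The matrix \<open>first_ff (\<phi> \<circ> x) u\<close> represents the pullback under \<open>\<phi>\<close> of the induced metric
  of \<open>U'\<close>.\<close>

definition isometry_between ::
  "'n::finite minkowski set \<Rightarrow> 'n minkowski set \<Rightarrow> ('n minkowski \<Rightarrow> 'n minkowski) \<Rightarrow> bool" where
  "isometry_between U U' \<phi> \<longleftrightarrow>
     bij_betw \<phi> U U' \<and> smooth_map U \<phi> \<and> smooth_map U' (inv_into U \<phi>) \<and>
     (\<forall>W x u. local_param U W x \<longrightarrow> u \<in> W \<longrightarrow> first_ff (\<phi> \<circ> x) u = first_ff x u)"

end

(*
The Gauss equation expresses the 2x2 minors of the second fundamental form h through the metric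
and its derivatives, so h and its counterpart h' in the chart transported by the isometry have the
same metric g and the same 2x2 minors. Any 3x3 principal block of h is positive definite by strict
convexity, and a 3x3 matrix of positive determinant is determined by its cofactor matrix; since
n >= 3 every entry of h lies in such a block. Hence h = h' (rigidity in the style of Beez), and the
principal curvatures agree, not just their symmetric functions.
*)
theory Submission
  imports Defs
begin

text \<open>\<open>unit_normal\<close> and \<open>principal_curvatures\<close> are descriptions over
  all charts, so independence of the chart has to be proved. A chart inverse is only continuous by
  definition, and the transition map is shown to be differentiable just at the point under study.
  Convexity speaks of roots of a determinant polynomial whereas the 3x3 blocks need a quadratic
  form; the minimum of the Rayleigh quotient links the two. Since \<open>-h\<close> has the same 2x2
  minors as \<open>h\<close>, positivity is what fixes the sign. The Gauss equation needs no
  curvature tensor: the \<open>mink\<close> products of first and second partial derivatives of the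
  position vector are functions of the metric, and differentiating them once more and
  antisymmetrising removes the third derivatives.\<close>

section \<open>Positive definite matrices and their minors\<close>

definition pos_def :: "real^'n^'n::finite \<Rightarrow> bool" where
  "pos_def A \<longleftrightarrow> (\<forall>v. v \<noteq> 0 \<longrightarrow> v \<bullet> (A *v v) > 0)"

lemma inner_mult_symmetric:
  fixes A :: "real^'n^'n::finite"
  assumes "transpose A = A"
  shows "v \<bullet> (A *v w) = w \<bullet> (A *v v)"
  by (metis assms dot_lmul_matrix inner_commute transpose_matrix_vector)

lemma inner_mult_axis:
  fixes A :: "real^'n^'n::finite"
  shows "axis i 1 \<bullet> (A *v axis j 1) = A $ i $ j"
  by (simp add: inner_axis' matrix_vector_mult_basis column_def)

lemma quadratic_form_sum:
  fixes A :: "real^'n^'n::finite"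
  assumes "transpose A = A"
  shows "(v + w) \<bullet> (A *v (v + w)) = v \<bullet> (A *v v) + 2 * (v \<bullet> (A *v w)) + w \<bullet> (A *v w)"
  using inner_mult_symmetric[OF assms, of v w]
  by (simp add: matrix_vector_right_distrib inner_add_left inner_add_right)

text \<open>Polarization. It allows the transformation of the fundamental forms to be checked on
  single vectors \<open>v\<close>, which is what limits along curves can detect.\<close>

lemma symmetric_matrix_eqI:
  fixes A B :: "real^'n^'n::finite"
  assumes "transpose A = A" "transpose B = B" and eq: "\<And>v. v \<bullet> (A *v v) = v \<bullet> (B *v v)"
  shows "A = B"
proof -
  have "v \<bullet> (A *v w) = v \<bullet> (B *v w)" for v w
    using quadratic_form_sum[OF assms(1), of v w] quadratic_form_sum[OF assms(2), of v w]
      eq[of "v + w"] eq[of v] eq[of w] by linarith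
  then show ?thesis
    by (metis (no_types, lifting) inner_mult_axis vec_eq_iff)
qed

text \<open>The matrix of \<open>2 \<times> 2\<close> minors of a \<open>3 \<times> 3\<close> matrix is its cofactor matrix, which determines
  the matrix up to sign: taking cofactors twice multiplies the matrix by its determinant \<open>\<Delta>\<close>, and
  the cofactor matrix has determinant \<open>\<Delta>\<^sup>2\<close>.\<close>

lemma symmetric_3x3_eq_if_minors_eq:
  fixes a b c d e f a' b' c' d' e' f' :: real
  assumes "d*f - e\<^sup>2 = d'*f' - e'\<^sup>2" "c*e - b*f = c'*e' - b'*f'" "b*e - c*d = b'*e' - c'*d'"
    and "a*f - c\<^sup>2 = a'*f' - c'\<^sup>2" "b*c - a*e = b'*c' - a'*e'" "a*d - b\<^sup>2 = a'*d' - b'\<^sup>2"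
    and pos: "a*(d*f - e\<^sup>2) + b*(c*e - b*f) + c*(b*e - c*d) > 0"
      "a'*(d'*f' - e'\<^sup>2) + b'*(c'*e' - b'*f') + c'*(b'*e' - c'*d') > 0"
  shows "a = a'" "b = b'"
proof -
  define \<Delta> where "\<Delta> = a*(d*f - e\<^sup>2) + b*(c*e - b*f) + c*(b*e - c*d)"
  define \<Delta>' where "\<Delta>' = a'*(d'*f' - e'\<^sup>2) + b'*(c'*e' - b'*f') + c'*(b'*e' - c'*d')"
  \<comment> \<open>For the matrix with rows (a, b, c), (b, d, e), (c, e, f), the letters
    \<open>A\<close> to \<open>F\<close> fill its cofactor matrix in the same pattern.\<close>
  define A B C D E F where "A = d*f - e\<^sup>2" "B = c*e - b*f" "C = b*e - c*d" "D = a*f - c\<^sup>2"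
    "E = b*c - a*e" "F = a*d - b\<^sup>2"
  note co = this
  have co': "A = d'*f' - e'\<^sup>2" "B = c'*e' - b'*f'" "C = b'*e' - c'*d'" "D = a'*f' - c'\<^sup>2"
    "E = b'*c' - a'*e'" "F = a'*d' - b'\<^sup>2"
    using assms(1-6) by (simp_all add: co)
  have "\<Delta>\<^sup>2 = A*(D*F - E\<^sup>2) + B*(C*E - B*F) + C*(B*E - C*D)"
    unfolding \<Delta>_def co by algebra
  also have "\<dots> = \<Delta>'\<^sup>2"
    unfolding \<Delta>'_def co' by algebra
  finally have "\<Delta> = \<Delta>'"
    using pos by (simp add: \<Delta>_def \<Delta>'_def power2_eq_iff_nonneg)
  moreover have "\<Delta> * a = D*F - E\<^sup>2" "\<Delta> * b = C*E - B*F"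
    unfolding \<Delta>_def co by algebra+
  moreover have "\<Delta>' * a' = D*F - E\<^sup>2" "\<Delta>' * b' = C*E - B*F"
    unfolding \<Delta>'_def co' by algebra+
  ultimately have "\<Delta> * a = \<Delta> * a'" "\<Delta> * b = \<Delta> * b'" by simp_all
  moreover have "\<Delta> \<noteq> 0" using pos by (simp add: \<Delta>_def)
  ultimately show "a = a'" "b = b'" by simp_all
qed

lemma pos_def_principal_3x3:
  fixes H :: "real^'n^'n::finite"
  assumes H: "pos_def H" "transpose H = H" and pqr: "p \<noteq> q" "p \<noteq> r" "q \<noteq> r"
  defines "a \<equiv> H$p$p" and "b \<equiv> H$p$q" and "c \<equiv> H$p$r"
    and "d \<equiv> H$q$q" and "e \<equiv> H$q$r" and "f \<equiv> H$r$r"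
  shows "a*(d*f - e\<^sup>2) + b*(c*e - b*f) + c*(b*e - c*d) > 0"
proof -
  have sym: "H$q$p = b" "H$r$p = c" "H$r$q = e"
    using H(2) by (auto simp: b_def c_def e_def transpose_def vec_eq_iff)
  let ?v = "\<lambda>x y z. x *\<^sub>R axis p 1 + y *\<^sub>R axis q 1 + z *\<^sub>R axis r (1::real) :: real^'n"
  have form: "?v x y z \<bullet> (H *v ?v x y z) =
      a*x\<^sup>2 + d*y\<^sup>2 + f*z\<^sup>2 + 2*b*x*y + 2*c*x*z + 2*e*y*z" for x y z
    by (simp add: matrix_vector_right_distrib matrix_vector_mult_scaleR inner_add_left
        inner_add_right inner_mult_axis sym)
      (simp add: a_def b_def c_def d_def e_def f_def algebra_simps power2_eq_square)
  have coords: "?v x y z $ p = x" "?v x y z $ q = y" "?v x y z $ r = z" for x y z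
    using pqr by (auto simp: axis_def)
  have pos: "a*x\<^sup>2 + d*y\<^sup>2 + f*z\<^sup>2 + 2*b*x*y + 2*c*x*z + 2*e*y*z > 0"
    if "x \<noteq> 0 \<or> y \<noteq> 0 \<or> z \<noteq> 0" for x y z
  proof -
    have "?v x y z \<noteq> 0" using that coords[of x y z] by (metis zero_index)
    then have "0 < ?v x y z \<bullet> (H *v ?v x y z)" using H(1) unfolding pos_def_def by blast
    then show ?thesis by (simp only: form)
  qed
  have a: "a > 0" using pos[of 1 0 0] by simp
  \<comment> \<open>The test vector (b, -a, 0) is, up to sign, the last column of the cofactor
    matrix of the 2x2 block on \<open>p\<close>, \<open>q\<close>.\<close>
  have "a * (a*d - b\<^sup>2) > 0"
    using pos[of b "-a" 0] a by (simp add: algebra_simps power2_eq_square)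
  then have F: "a*d - b\<^sup>2 > 0" using a by (simp add: zero_less_mult_iff)
  \<comment> \<open>The test vector is now the last column of the 3x3 cofactor matrix. The block
    maps it to (0, 0, det), so the form takes the value det times its last coordinate
    \<open>a*d - b\<^sup>2\<close>, which is positive already.\<close>
  have "(a*d - b\<^sup>2) * (a*(d*f - e\<^sup>2) + b*(c*e - b*f) + c*(b*e - c*d)) =
     a*(b*e - c*d)\<^sup>2 + d*(b*c - a*e)\<^sup>2 + f*(a*d - b\<^sup>2)\<^sup>2 + 2*b*(b*e - c*d)*(b*c - a*e)
     + 2*c*(b*e - c*d)*(a*d - b\<^sup>2) + 2*e*(b*c - a*e)*(a*d - b\<^sup>2)"
    by algebra
  also have "\<dots> > 0"
    using F by (intro pos) auto
  finally show ?thesis using F by (simp add: zero_less_mult_iff)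
qed

lemma ex_third_element:
  assumes "CARD('n::finite) \<ge> 3"
  shows "\<exists>k::'n. k \<noteq> i \<and> k \<noteq> j"
proof -
  have "card {i, j} < CARD('n)"
    using assms card_insert_le_m1[of 2 "{j}" i] by (simp add: card_insert_if)
  then have "{i, j} \<noteq> UNIV" by auto
  then show ?thesis by auto
qed

text \<open>The minors with rows \<open>i\<close>, \<open>l\<close> and columns \<open>j\<close>,
  \<open>k\<close> appear in the shape in which the Gauss equation delivers them. With only two
  indices they would prescribe nothing but the determinant; the third index supplies the remaining
  cofactors.\<close>

lemma pos_def_eq_if_minors_eq:
  fixes H K :: "real^'n^'n::finite"
  assumes n: "CARD('n) \<ge> 3"
    and H: "pos_def H" "transpose H = H" and K: "pos_def K" "transpose K = K"
    and minors: "\<And>i j k l. H$i$j * H$l$k - H$l$j * H$i$k = K$i$j * K$l$k - K$l$j * K$i$k"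
  shows "H = K"
proof -
  have sym: "H$i$j = H$j$i" "K$i$j = K$j$i" for i j
    using arg_cong[OF H(2), of "\<lambda>A. A$j$i"] arg_cong[OF K(2), of "\<lambda>A. A$j$i"]
    by (simp_all add: transpose_def)
  have *: "H$p$p = K$p$p" "H$p$q = K$p$q" if pqr: "p \<noteq> q" "p \<noteq> r" "q \<noteq> r" for p q r
  proof -
    have m: "H$q$q * H$r$r - (H$q$r)\<^sup>2 = K$q$q * K$r$r - (K$q$r)\<^sup>2"
        "H$p$r * H$q$r - H$p$q * H$r$r = K$p$r * K$q$r - K$p$q * K$r$r"
        "H$p$q * H$q$r - H$p$r * H$q$q = K$p$q * K$q$r - K$p$r * K$q$q"
        "H$p$p * H$r$r - (H$p$r)\<^sup>2 = K$p$p * K$r$r - (K$p$r)\<^sup>2"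
        "H$p$q * H$p$r - H$p$p * H$q$r = K$p$q * K$p$r - K$p$p * K$q$r"
        "H$p$p * H$q$q - (H$p$q)\<^sup>2 = K$p$p * K$q$q - (K$p$q)\<^sup>2"
      using minors[of q q r r] minors[of p r r q] minors[of p q q r] minors[of p p r r]
        minors[of p q r p] minors[of p p q q]
        sym[of q p] sym[of r p] sym[of r q]
      unfolding power2_eq_square by (metis mult.commute)+
    show "H$p$p = K$p$p" "H$p$q = K$p$q"
      by (rule symmetric_3x3_eq_if_minors_eq[OF m pos_def_principal_3x3[OF H pqr]
          pos_def_principal_3x3[OF K pqr]])+
  qed
  have "H$i$j = K$i$j" for i j
  proof (cases "i = j")
    case True
    obtain q where q: "q \<noteq> i" using ex_third_element[OF n, of i i] by auto
    obtain r where "r \<noteq> i" "r \<noteq> q" using ex_third_element[OF n, of i q] by auto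
    then show ?thesis using *(1)[of i q r] q True by simp
  next
    case False
    obtain r where "r \<noteq> i" "r \<noteq> j" using ex_third_element[OF n, of i j] by auto
    then show ?thesis using *(2)[of i j r] False by simp
  qed
  then show ?thesis by (simp add: vec_eq_iff)
qed

section \<open>Eigenvalues of a symmetric matrix relative to a positive definite one\<close>

lemma poly_det_pencil:
  "poly (det (\<chi> i j. [: h $ i $ j, - (g $ i $ j) :])) t = det (h - t *\<^sub>R g)"
  for h g :: "real^'n^'n::finite"
proof -
  have sgn: "poly (of_int k) t = of_int k" for k :: int
    by (metis of_int_poly poly_pCons poly_0 mult_zero_right add.right_neutral)
  show ?thesis
    by (simp add: det_def poly_sum poly_prod sgn algebra_simps)
qed

lemma pos_def_det_nonzero:
  fixes A :: "real^'n^'n::finite"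
  assumes "pos_def A"
  shows "det A \<noteq> 0"
proof
  assume "det A = 0"
  then obtain v where "v \<noteq> 0" "A *v v = 0"
    by (metis invertible_det_nz invertible_left_inverse matrix_left_invertible_ker)
  then show False using assms by (auto simp: pos_def_def)
qed

text \<open>A zero of a nonnegative form is a minimum, and moving from \<open>v\<close> against
  \<open>A *v v\<close> would decrease the form to first order.\<close>

lemma pos_semidef_null_vector:
  fixes A :: "real^'n^'n::finite"
  assumes sym: "transpose A = A" and nonneg: "\<And>v. v \<bullet> (A *v v) \<ge> 0" and v: "v \<bullet> (A *v v) = 0"
  shows "A *v v = 0"
proof (rule ccontr)
  define w where "w = A *v v"
  assume "A *v v \<noteq> 0"
  then have pos: "w \<bullet> w > 0" by (simp add: w_def)
  define q where "q = w \<bullet> (A *v w)"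
  have q: "q \<ge> 0" unfolding q_def by (rule nonneg)
  \<comment> \<open>Along \<open>w\<close> the form is 2t|w|^2 + t^2 q. This \<open>t\<close> turns
    it into -t^2 (q + 2), and \<open>q + 1\<close> keeps the denominator positive when q =
    0.\<close>
  define t where "t = - (w \<bullet> w) / (q + 1)"
  have t: "w \<bullet> w = - t * (q + 1)" using q by (simp add: t_def)
  have "(v + t *\<^sub>R w) \<bullet> (A *v (v + t *\<^sub>R w)) = 2 * t * (w \<bullet> w) + t\<^sup>2 * q"
    using quadratic_form_sum[OF sym, of v "t *\<^sub>R w"] v inner_mult_symmetric[OF sym, of v w]
    by (simp add: matrix_vector_mult_scaleR q_def w_def power2_eq_square)
  also have "\<dots> = - (t\<^sup>2 * (q + 2))"
    by (simp add: t algebra_simps power2_eq_square)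
  also have "\<dots> < 0" using pos q by (simp add: t_def)
  finally show False using nonneg by (metis not_le)
qed

text \<open>The least value of the Rayleigh quotient of \<open>h\<close> with respect to \<open>g\<close> is one of the relative
  eigenvalues.\<close>

lemma pos_def_if_rel_eigenvalues_pos:
  fixes h g :: "real^'n^'n::finite"
  assumes g: "pos_def g" "transpose g = g" and h: "transpose h = h"
    and pos: "\<And>\<kappa>. \<kappa> \<in> set (rel_eigenvalues h g) \<Longrightarrow> \<kappa> > 0"
  shows "pos_def h"
proof -
  let ?S = "sphere (0::real^'n) 1"
  define R where "R = (\<lambda>v::real^'n. (v \<bullet> (h *v v)) / (v \<bullet> (g *v v)))"
  have gpos: "v \<bullet> (g *v v) > 0" if "v \<noteq> 0" for v using g(1) that by (simp add: pos_def_def)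
  have "continuous_on ?S R"
    unfolding R_def
    by (intro continuous_intros linear_continuous_on linear_linear[THEN iffD1] matrix_vector_mul_linear)
      (metis gpos less_irrefl mem_sphere_0 norm_zero zero_neq_one)
  moreover have "?S \<noteq> {}"
    by (simp add: sphere_eq_empty)
  ultimately obtain v where v: "v \<in> ?S" and min: "\<And>w. w \<in> ?S \<Longrightarrow> R v \<le> R w"
    using continuous_attains_inf[OF compact_sphere, of 0 1 R] by auto
  define m where "m = R v"
  have v0: "v \<noteq> 0" using v by auto
  have ineq: "w \<bullet> (h *v w) \<ge> m * (w \<bullet> (g *v w))" for w
  proof (cases "w = 0")
    case False
    have "R (w /\<^sub>R norm w) = R w"
      using False by (simp add: R_def matrix_vector_mult_scaleR)
    moreover have "w /\<^sub>R norm w \<in> ?S" using False by simp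
    ultimately have "m \<le> R w" using min m_def by metis
    then show ?thesis using gpos[OF False] by (simp add: R_def pos_le_divide_eq)
  qed simp
  have form: "w \<bullet> ((h - t *\<^sub>R g) *v w) = w \<bullet> (h *v w) - t * (w \<bullet> (g *v w))" for w t
    by (simp add: matrix_vector_mult_diff_rdistrib scaleR_matrix_vector_assoc[symmetric] inner_diff_right)
  have "(h - m *\<^sub>R g) *v v = 0"
  proof (rule pos_semidef_null_vector)
    show "transpose (h - m *\<^sub>R g) = h - m *\<^sub>R g"
      using g(2) h by (simp add: transpose_def vec_eq_iff)
    show "w \<bullet> ((h - m *\<^sub>R g) *v w) \<ge> 0" for w using ineq[of w] form by simp
    show "v \<bullet> ((h - m *\<^sub>R g) *v v) = 0"
      using gpos[OF v0] by (simp add: form m_def R_def)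
  qed
  then have root: "det (h - m *\<^sub>R g) = 0"
    using v0 by (metis invertible_det_nz invertible_left_inverse matrix_left_invertible_ker)
  \<comment> \<open>\<open>proots\<close> of the zero polynomial is empty, so a zero of the
    determinant counts only if the polynomial does not vanish identically. At \<open>m - 1\<close>
    the pencil dominates \<open>g\<close>, hence is nonsingular.\<close>
  have "pos_def (h - (m - 1) *\<^sub>R g)"
    unfolding pos_def_def
  proof (intro allI impI)
    fix w :: "real^'n" assume "w \<noteq> 0"
    then show "0 < w \<bullet> ((h - (m - 1) *\<^sub>R g) *v w)"
      unfolding form using ineq[of w] gpos[of w] by (simp add: algebra_simps)
  qed
  then have "det (h - (m - 1) *\<^sub>R g) \<noteq> 0" by (rule pos_def_det_nonzero)
  then have "det (\<chi> i j. [: h $ i $ j, - (g $ i $ j) :]) \<noteq> 0"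
    using poly_det_pencil[of h g "m - 1"] by auto
  then have "m \<in> set (rel_eigenvalues h g)"
    using root by (simp add: rel_eigenvalues_def poly_det_pencil)
  then have "m > 0" by (rule pos)
  then show ?thesis
    unfolding pos_def_def using ineq gpos by (meson less_le_trans mult_pos_pos)
qed

text \<open>The pencil's determinant is multiplied by the nonzero constant (det J)^2, which
  preserves roots and multiplicities. Both fundamental forms change by such a congruence under a
  change of chart.\<close>

lemma rel_eigenvalues_congruence:
  fixes h g J :: "real^'n^'n::finite"
  assumes "det J \<noteq> 0"
  shows "rel_eigenvalues (transpose J ** h ** J) (transpose J ** g ** J) = rel_eigenvalues h g"
proof -
  let ?P = "\<lambda>(h::real^'n^'n) (g::real^'n^'n). det (\<chi> i j. [: h $ i $ j, - (g $ i $ j) :])"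
  have "poly (?P (transpose J ** h ** J) (transpose J ** g ** J)) t = poly (smult ((det J)\<^sup>2) (?P h g)) t"
    for t
  proof -
    have "transpose J ** h ** J - t *\<^sub>R (transpose J ** g ** J) = transpose J ** (h - t *\<^sub>R g) ** J"
      by (simp add: matrix_eq del: transpose_matrix_vector flip: matrix_vector_mul_assoc)
        (simp del: transpose_matrix_vector add: matrix_vector_mult_diff_rdistrib matrix_vector_mult_diff_distrib
            scaleR_matrix_vector_assoc[symmetric] matrix_vector_mult_scaleR
            flip: matrix_vector_mul_assoc)
    then show ?thesis
      unfolding poly_smult poly_det_pencil
      by (simp add: det_mul det_transpose power2_eq_square)
  qed
  then have "?P (transpose J ** h ** J) (transpose J ** g ** J) = smult ((det J)\<^sup>2) (?P h g)"
    by (rule poly_eq_poly_eq_iff[THEN iffD1, OF ext])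
  then show ?thesis
    using assms by (simp add: rel_eigenvalues_def)
qed

section \<open>Calculus of second order at a single point: symmetry and Taylor expansion\<close>

section \<open>Second derivatives\<close>

lemma partial_deriv_cong_open:
  assumes "open W" "u \<in> W" "\<And>w. w \<in> W \<Longrightarrow> f w = g w"
  shows "partial_deriv i f u = partial_deriv i g u"
proof -
  have "(f has_derivative D) (at u) \<longleftrightarrow> (g has_derivative D) (at u)" for D
    using assms has_derivative_transform_within_open[of f D u UNIV W g]
      has_derivative_transform_within_open[of g D u UNIV W f] by auto
  then show ?thesis by (simp add: partial_deriv_def frechet_derivative_def)
qed

lemma frechet_derivative_sum_partial_deriv:
  fixes f :: "real^'n::finite \<Rightarrow> 'b::real_normed_vector"
  assumes "f differentiable (at u)"
  shows "frechet_derivative f (at u) v = (\<Sum>i\<in>UNIV. v $ i *\<^sub>R partial_deriv i f u)"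
proof -
  interpret linear "frechet_derivative f (at u)"
    by (rule linear_frechet_derivative[OF assms])
  have "v = (\<Sum>i\<in>UNIV. v $ i *\<^sub>R axis i 1)"
    using basis_expansion[of v] by (simp add: scalar_mult_eq_scaleR)
  then have "frechet_derivative f (at u) v = frechet_derivative f (at u) (\<Sum>i\<in>UNIV. v $ i *\<^sub>R axis i 1)"
    by simp
  then show ?thesis by (simp add: sum scale partial_deriv_def)
qed

lemma partial_deriv_bounded_linear:
  assumes "bounded_linear L" "f differentiable (at u)"
  shows "partial_deriv i (\<lambda>w. L (f w)) u = L (partial_deriv i f u)"
proof -
  have "((\<lambda>w. L (f w)) has_derivative (\<lambda>h. L (frechet_derivative f (at u) h))) (at u)"
    using assms bounded_linear.has_derivative frechet_derivative_works by blast
  then show ?thesis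
    by (simp add: partial_deriv_def frechet_derivative_at[symmetric])
qed

lemma partial_deriv_bilinear:
  assumes "bounded_bilinear B" "f differentiable (at u)" "g differentiable (at u)"
  shows "partial_deriv i (\<lambda>w. B (f w) (g w)) u = B (partial_deriv i f u) (g u) + B (f u) (partial_deriv i g u)"
proof -
  have "((\<lambda>w. B (f w) (g w)) has_derivative (\<lambda>h. B (f u) (frechet_derivative g (at u) h)
      + B (frechet_derivative f (at u) h) (g u))) (at u)"
    using assms by (intro bounded_bilinear.FDERIV) (auto simp: frechet_derivative_works)
  then show ?thesis
    by (simp add: partial_deriv_def frechet_derivative_at[symmetric])
qed

text \<open>Weaker than C^2: the second partial derivatives are required at \<open>u\<close> only,
  with no continuity.\<close>

definition twice_diff_at :: "(real^'n::finite) \<Rightarrow> (real^'n \<Rightarrow> 'b::real_normed_vector) \<Rightarrow> bool" where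
  "twice_diff_at u f \<longleftrightarrow> (\<exists>W. open W \<and> u \<in> W \<and> (\<forall>w\<in>W. f differentiable (at w))) \<and>
     (\<forall>i. partial_deriv i f differentiable (at u))"

text \<open>The Hessian as a bilinear form; \<open>w\<close> is the direction of the outer
  differentiation and \<open>c\<close> that of the inner one.\<close>

definition second_derivative :: "(real^'n::finite \<Rightarrow> 'b::real_normed_vector) \<Rightarrow> real^'n \<Rightarrow> real^'n \<Rightarrow> real^'n \<Rightarrow> 'b" where
  "second_derivative f u w c =
     (\<Sum>j\<in>UNIV. c $ j *\<^sub>R frechet_derivative (partial_deriv j f) (at u) w)"

lemma second_derivative_bilinear:
  fixes f :: "real^'n::finite \<Rightarrow> real"
  assumes "twice_diff_at u f"
  shows "bounded_bilinear (second_derivative f u)"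
proof -
  have l: "linear (frechet_derivative (partial_deriv j f) (at u))" for j
    using assms by (auto simp: twice_diff_at_def intro: linear_frechet_derivative)
  show ?thesis
    unfolding bilinear_conv_bounded_bilinear[symmetric] bilinear_def
    by (auto simp: linear_iff second_derivative_def linear_add[OF l] linear_scale[OF l]
        algebra_simps sum.distrib sum_distrib_left)
qed

lemma second_derivative_axis:
  "second_derivative f u (axis i 1) (axis j 1) = partial_deriv i (partial_deriv j f) u"
proof -
  have "second_derivative f u (axis i 1) (axis j 1) =
      (\<Sum>k\<in>UNIV. if k = j then frechet_derivative (partial_deriv k f) (at u) (axis i 1) else 0)"
    unfolding second_derivative_def by (intro sum.cong) (auto simp: axis_def)
  then show ?thesis by (simp add: partial_deriv_def)
qed

text \<open>The common estimate behind symmetry of mixed derivatives and Taylor's formula. Each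
  first partial is differentiable at \<open>u\<close> with tolerance \<open>e / n\<close>, and the n
  coordinates of \<open>c\<close> add these up to \<open>e\<close>.\<close>

lemma derivative_increment_bound:
  fixes f :: "real^'n::finite \<Rightarrow> real"
  assumes f: "twice_diff_at u f" and e: "e > 0"
  shows "\<exists>d>0. \<forall>w. norm w < d \<longrightarrow> f differentiable (at (u + w)) \<and>
     (\<forall>c. \<bar>frechet_derivative f (at (u + w)) c - frechet_derivative f (at u) c
        - second_derivative f u w c\<bar> \<le> e * norm w * norm c)"
proof -
  define n where "n = real CARD('n)"
  have n: "n > 0" by (simp add: n_def)
  obtain W where W: "open W" "u \<in> W" "\<And>w. w \<in> W \<Longrightarrow> f differentiable (at w)"
    using f by (auto simp: twice_diff_at_def)
  obtain d0 where d0: "d0 > 0" "ball u d0 \<subseteq> W" using W(1,2) open_contains_ball by blast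
  have "\<exists>d>0. \<forall>y. norm (y - u) < d \<longrightarrow>
      norm (partial_deriv j f y - partial_deriv j f u - frechet_derivative (partial_deriv j f) (at u) (y - u))
        \<le> e / n * norm (y - u)" for j
  proof -
    have "(partial_deriv j f has_derivative frechet_derivative (partial_deriv j f) (at u)) (at u)"
      using f by (simp add: twice_diff_at_def frechet_derivative_works)
    moreover have "e / n > 0" using e n by simp
    ultimately show ?thesis unfolding has_derivative_at_alt by blast
  qed
  then obtain d where d: "\<And>j. d j > 0" "\<And>j y. norm (y - u) < d j \<Longrightarrow>
      norm (partial_deriv j f y - partial_deriv j f u - frechet_derivative (partial_deriv j f) (at u) (y - u))
        \<le> e / n * norm (y - u)"
    by metis
  define d1 where "d1 = min d0 (Min (range d))"
  have d1: "d1 > 0" "d1 \<le> d0" "\<And>j. d1 \<le> d j"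
    using d0 d(1) by (auto simp: d1_def min_le_iff_disj)
  show ?thesis
  proof (intro exI[of _ d1] conjI allI impI d1(1))
    fix w :: "real^'n" assume w: "norm w < d1"
    have "u + w \<in> W" using w d1 d0 by (auto simp: dist_norm subset_iff)
    then show diff: "f differentiable (at (u + w))" by (rule W(3))
    fix c :: "real^'n"
    have "\<bar>frechet_derivative f (at (u + w)) c - frechet_derivative f (at u) c - second_derivative f u w c\<bar>
      = \<bar>\<Sum>j\<in>UNIV. c $ j * (partial_deriv j f (u + w) - partial_deriv j f u
            - frechet_derivative (partial_deriv j f) (at u) w)\<bar>"
      by (simp add: frechet_derivative_sum_partial_deriv[OF diff]
          frechet_derivative_sum_partial_deriv[OF W(3)[OF W(2)]] second_derivative_def
          sum_subtractf sum.distrib algebra_simps)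
    also have "\<dots> \<le> (\<Sum>j\<in>(UNIV::'n set). norm c * (e / n * norm w))"
    proof (rule order_trans[OF sum_abs], rule sum_mono)
      fix j
      have "\<bar>partial_deriv j f (u + w) - partial_deriv j f u
            - frechet_derivative (partial_deriv j f) (at u) w\<bar> \<le> e / n * norm w"
        using d(2)[of "u + w" j] w d1(3)[of j] by simp
      then show "\<bar>c $ j * (partial_deriv j f (u + w) - partial_deriv j f u
            - frechet_derivative (partial_deriv j f) (at u) w)\<bar> \<le> norm c * (e / n * norm w)"
        unfolding abs_mult by (intro mult_mono component_le_norm_cart) auto
    qed
    also have "\<dots> = e * norm w * norm c" using n by (simp add: n_def)
    finally show "\<bar>frechet_derivative f (at (u + w)) c - frechet_derivative f (at u) c
        - second_derivative f u w c\<bar> \<le> e * norm w * norm c" .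
  qed
qed

text \<open>Both mixed derivatives are limits of the second difference quotient, which is symmetric in
  the two directions.\<close>

lemma second_difference_bound:
  fixes f :: "real^'n::finite \<Rightarrow> real"
  assumes f: "twice_diff_at u f" and e: "e > 0"
  shows "\<exists>d>0. \<forall>t. 0 < t \<longrightarrow> t < d \<longrightarrow>
    \<bar>f (u + t *\<^sub>R h + t *\<^sub>R v) - f (u + t *\<^sub>R h) - f (u + t *\<^sub>R v) + f u
      - t\<^sup>2 * second_derivative f u v h\<bar> \<le> e * t\<^sup>2"
proof -
  interpret Q: bounded_bilinear "second_derivative f u" by (rule second_derivative_bilinear[OF f])
  \<comment> \<open>The two remainders below contribute t^2 times (2|h| + |v|)|h|, which is
    \<open>K - 1\<close>; the added 1 makes \<open>K\<close> positive.\<close>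
  define K where "K = (2 * norm h + norm v) * norm h + 1"
  have K: "K > 0" by (simp add: K_def add_nonneg_pos)
  obtain d where d: "d > 0" "\<And>w. norm w < d \<Longrightarrow> f differentiable (at (u + w))"
    "\<And>w c. norm w < d \<Longrightarrow> \<bar>frechet_derivative f (at (u + w)) c - frechet_derivative f (at u) c
        - second_derivative f u w c\<bar> \<le> e / K * norm w * norm c"
    using derivative_increment_bound[OF f, of "e / K"] e K by auto
  define M where "M = norm h + norm v + 1"
  have M: "M > 0" by (simp add: M_def add_nonneg_pos)
  show ?thesis
  proof (intro exI[of _ "d / M"] conjI allI impI)
    show "d / M > 0" using d(1) M by simp
    fix t :: real assume t: "0 < t" "t < d / M"
    have tM: "t * M < d" using t(2) M by (simp add: pos_less_divide_eq)
    have small: "norm (s *\<^sub>R h + r *\<^sub>R v) < d" if "0 \<le> s" "s \<le> t" "0 \<le> r" "r \<le> t" for s r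
    proof -
      have "norm (s *\<^sub>R h + r *\<^sub>R v) \<le> s * norm h + r * norm v"
        using that norm_triangle_ineq[of "s *\<^sub>R h" "r *\<^sub>R v"] by simp
      also have "\<dots> \<le> t * norm h + t * norm v"
        using that by (intro add_mono mult_right_mono) auto
      also have "\<dots> \<le> t * M" using t(1) by (simp add: M_def algebra_simps)
      finally show ?thesis using tM by simp
    qed
    \<comment> \<open>The second difference is the increment of \<phi> over [0, t], so one
      application of the mean value theorem in direction \<open>h\<close> leaves a difference of
      first derivatives.\<close>
    define \<phi> where "\<phi> = (\<lambda>s. f (u + (s *\<^sub>R h + t *\<^sub>R v)) - f (u + s *\<^sub>R h))"
    have "\<exists>s\<in>{0<..<t}. \<phi> t - \<phi> 0 = (\<lambda>s r. r * (frechet_derivative f (at (u + (s *\<^sub>R h + t *\<^sub>R v))) h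
        - frechet_derivative f (at (u + s *\<^sub>R h)) h)) s (t - 0)"
    proof (rule mvt_simple[OF t(1)])
      fix s assume s: "0 \<le> s" "s \<le> t"
      have D1: "f differentiable (at (u + (s *\<^sub>R h + t *\<^sub>R v)))"
        using d(2)[OF small[of s t]] s t by simp
      have D2: "f differentiable (at (u + s *\<^sub>R h))"
        using d(2)[OF small[of s 0]] s t by simp
      have "((\<lambda>s. f (u + (s *\<^sub>R h + t *\<^sub>R v))) has_derivative
          (\<lambda>r. frechet_derivative f (at (u + (s *\<^sub>R h + t *\<^sub>R v))) (r *\<^sub>R h))) (at s within {0..t})"
        using D1[unfolded frechet_derivative_works]
        by (rule has_derivative_compose[rotated]) (auto intro!: derivative_eq_intros)
      moreover have "((\<lambda>s. f (u + s *\<^sub>R h)) has_derivative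
          (\<lambda>r. frechet_derivative f (at (u + s *\<^sub>R h)) (r *\<^sub>R h))) (at s within {0..t})"
        using D2[unfolded frechet_derivative_works]
        by (rule has_derivative_compose[rotated]) (auto intro!: derivative_eq_intros)
      ultimately show "(\<phi> has_derivative (\<lambda>r. r * (frechet_derivative f (at (u + (s *\<^sub>R h + t *\<^sub>R v))) h
        - frechet_derivative f (at (u + s *\<^sub>R h)) h))) (at s within {0..t})"
        unfolding \<phi>_def
        by (auto intro!: derivative_eq_intros
            simp: linear_scale[OF linear_frechet_derivative[OF D1]]
              linear_scale[OF linear_frechet_derivative[OF D2]] algebra_simps)
    qed
    then obtain s where s: "0 < s" "s < t" and eq: "\<phi> t - \<phi> 0 =
        t * (frechet_derivative f (at (u + (s *\<^sub>R h + t *\<^sub>R v))) h - frechet_derivative f (at (u + s *\<^sub>R h)) h)"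
      by auto
    define R where "R = (\<lambda>w. frechet_derivative f (at (u + w)) h - frechet_derivative f (at u) h
        - second_derivative f u w h)"
    have n1: "norm (s *\<^sub>R h + t *\<^sub>R v) \<le> t * (norm h + norm v)"
    proof -
      have "norm (s *\<^sub>R h + t *\<^sub>R v) \<le> s * norm h + t * norm v"
        using s t norm_triangle_ineq[of "s *\<^sub>R h" "t *\<^sub>R v"] by simp
      also have "\<dots> \<le> t * norm h + t * norm v" using s by (intro add_mono mult_right_mono) auto
      finally show ?thesis by (simp add: algebra_simps)
    qed
    have n2: "norm (s *\<^sub>R h) \<le> t * norm h" using s by (simp add: mult_right_mono)
    have eK: "e / K \<ge> 0" using e K by simp
    have "\<bar>R (s *\<^sub>R h + t *\<^sub>R v)\<bar> \<le> e / K * norm (s *\<^sub>R h + t *\<^sub>R v) * norm h"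
      unfolding R_def using d(3)[OF small[of s t]] s t by simp
    also have "\<dots> \<le> e / K * (t * (norm h + norm v)) * norm h"
      using n1 eK by (intro mult_right_mono mult_left_mono) auto
    finally have R1: "\<bar>R (s *\<^sub>R h + t *\<^sub>R v)\<bar> \<le> e / K * (t * (norm h + norm v)) * norm h" .
    have "\<bar>R (s *\<^sub>R h)\<bar> \<le> e / K * norm (s *\<^sub>R h) * norm h"
      unfolding R_def using d(3)[OF small[of s 0]] s t by simp
    also have "\<dots> \<le> e / K * (t * norm h) * norm h"
      using n2 eK by (intro mult_right_mono mult_left_mono) auto
    finally have R2: "\<bar>R (s *\<^sub>R h)\<bar> \<le> e / K * (t * norm h) * norm h" .
    \<comment> \<open>The derivatives at \<open>u\<close> cancel, and so does the unknown
      \<open>s\<close>: by linearity the Hessian at \<open>s *\<^sub>R h + t *\<^sub>R v\<close>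
      minus that at \<open>s *\<^sub>R h\<close> is \<open>t\<close> times its value at
      \<open>v\<close>.\<close>
    have "frechet_derivative f (at (u + (s *\<^sub>R h + t *\<^sub>R v))) h - frechet_derivative f (at (u + s *\<^sub>R h)) h
        = t * second_derivative f u v h + (R (s *\<^sub>R h + t *\<^sub>R v) - R (s *\<^sub>R h))"
      by (simp add: R_def Q.add_left Q.scaleR_left)
    then have "\<phi> t - \<phi> 0 - t\<^sup>2 * second_derivative f u v h = t * (R (s *\<^sub>R h + t *\<^sub>R v) - R (s *\<^sub>R h))"
      unfolding eq by (simp only: right_diff_distrib distrib_left power2_eq_square)
    then have "\<bar>\<phi> t - \<phi> 0 - t\<^sup>2 * second_derivative f u v h\<bar> = t * \<bar>R (s *\<^sub>R h + t *\<^sub>R v) - R (s *\<^sub>R h)\<bar>"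
      using t by (simp add: abs_mult)
    also have "\<dots> \<le> t * (e / K * (t * (norm h + norm v)) * norm h + e / K * (t * norm h) * norm h)"
      using R1 R2 t by (intro mult_left_mono) linarith+
    also have "\<dots> = e * t\<^sup>2 * ((K - 1) / K)"
      by (simp add: K_def algebra_simps power2_eq_square add_divide_distrib)
    also have "\<dots> \<le> e * t\<^sup>2 * 1"
      using e K by (intro mult_left_mono) auto
    finally show "\<bar>f (u + t *\<^sub>R h + t *\<^sub>R v) - f (u + t *\<^sub>R h) - f (u + t *\<^sub>R v) + f u
      - t\<^sup>2 * second_derivative f u v h\<bar> \<le> e * t\<^sup>2"
      by (simp add: \<phi>_def algebra_simps)
  qed
qed

lemma second_derivative_commute_real:
  fixes f :: "real^'n::finite \<Rightarrow> real"
  assumes f: "twice_diff_at u f"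
  shows "second_derivative f u v h = second_derivative f u h v"
proof -
  have "\<bar>second_derivative f u v h - second_derivative f u h v\<bar> \<le> e" if e: "e > 0" for e
  proof -
    obtain d1 where d1: "d1 > 0" "\<And>t. 0 < t \<Longrightarrow> t < d1 \<Longrightarrow>
      \<bar>f (u + t *\<^sub>R h + t *\<^sub>R v) - f (u + t *\<^sub>R h) - f (u + t *\<^sub>R v) + f u
        - t\<^sup>2 * second_derivative f u v h\<bar> \<le> e / 2 * t\<^sup>2"
      using second_difference_bound[OF f half_gt_zero[OF e], of h v] by blast
    obtain d2 where d2: "d2 > 0" "\<And>t. 0 < t \<Longrightarrow> t < d2 \<Longrightarrow>
      \<bar>f (u + t *\<^sub>R v + t *\<^sub>R h) - f (u + t *\<^sub>R v) - f (u + t *\<^sub>R h) + f u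
        - t\<^sup>2 * second_derivative f u h v\<bar> \<le> e / 2 * t\<^sup>2"
      using second_difference_bound[OF f half_gt_zero[OF e], of v h] by blast
    define t where "t = min d1 d2 / 2"
    have t: "0 < t" "t < d1" "t < d2" using d1(1) d2(1) by (auto simp: t_def)
    have "u + t *\<^sub>R v + t *\<^sub>R h = u + t *\<^sub>R h + t *\<^sub>R v" by simp
    then have "\<bar>t\<^sup>2 * second_derivative f u v h - t\<^sup>2 * second_derivative f u h v\<bar> \<le> e * t\<^sup>2"
      using d1(2)[OF t(1,2)] d2(2)[OF t(1,3)] by (simp only: abs_le_iff) linarith
    then have "\<bar>t\<^sup>2 * (second_derivative f u v h - second_derivative f u h v)\<bar> \<le> t\<^sup>2 * e"
      by (simp only: right_diff_distrib mult.commute[of e])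
    then show ?thesis using t(1) by (simp add: abs_mult)
  qed
  then show ?thesis
    using dense_ge[of 0 "\<bar>second_derivative f u v h - second_derivative f u h v\<bar>"] by simp
qed

text \<open>Pairing with a fixed vector reduces to real functions. For charts this pairing is the
  Euclidean inner product of the ambient space, not \<open>mink\<close>.\<close>

lemma partial_deriv_commute:
  fixes f :: "real^'n::finite \<Rightarrow> 'b::real_inner"
  assumes f: "twice_diff_at u f"
  shows "partial_deriv i (partial_deriv j f) u = partial_deriv j (partial_deriv i f) u"
proof -
  obtain W where W: "open W" "u \<in> W" "\<And>w. w \<in> W \<Longrightarrow> f differentiable (at w)"
    using f by (auto simp: twice_diff_at_def)
  have d: "partial_deriv k f differentiable (at u)" for k using f by (auto simp: twice_diff_at_def)
  have "partial_deriv i (partial_deriv j f) u \<bullet> b = partial_deriv j (partial_deriv i f) u \<bullet> b" for b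
  proof -
    let ?g = "\<lambda>w. f w \<bullet> b"
    have bl: "bounded_linear (\<lambda>z. z \<bullet> b)" by (rule bounded_linear_inner_left)
    have p: "partial_deriv k ?g w = partial_deriv k f w \<bullet> b" if "w \<in> W" for k w
      by (rule partial_deriv_bounded_linear[OF bl W(3)[OF that]])
    have pp: "partial_deriv k (partial_deriv l ?g) u = partial_deriv k (partial_deriv l f) u \<bullet> b" for k l
    proof -
      have "partial_deriv k (partial_deriv l ?g) u = partial_deriv k (\<lambda>w. partial_deriv l f w \<bullet> b) u"
        by (rule partial_deriv_cong_open[OF W(1,2)]) (rule p)
      also have "\<dots> = partial_deriv k (partial_deriv l f) u \<bullet> b"
        by (rule partial_deriv_bounded_linear[OF bl d])
      finally show ?thesis .
    qed
    have "partial_deriv k ?g differentiable (at u)" for k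
    proof -
      have "((\<lambda>w. partial_deriv k f w \<bullet> b) has_derivative
          (\<lambda>h. frechet_derivative (partial_deriv k f) (at u) h \<bullet> b)) (at u)"
        by (rule bounded_linear.has_derivative[OF bl d[of k, unfolded frechet_derivative_works]])
      then have "(partial_deriv k ?g has_derivative
          (\<lambda>h. frechet_derivative (partial_deriv k f) (at u) h \<bullet> b)) (at u)"
        by (rule has_derivative_transform_within_open[OF _ W(1,2)]) (rule p[symmetric])
      then show ?thesis by (rule differentiableI)
    qed
    moreover have "?g differentiable (at w)" if "w \<in> W" for w
      by (rule differentiableI[OF bounded_linear.has_derivative[OF bl
            W(3)[OF that, unfolded frechet_derivative_works]]])
    ultimately have "twice_diff_at u ?g"
      unfolding twice_diff_at_def using W(1,2) by blast
    from second_derivative_commute_real[OF this, of "axis i 1" "axis j 1"] show ?thesis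
      unfolding second_derivative_axis pp .
  qed
  then show ?thesis by (rule vector_eq_rdot[THEN iffD1, OF allI])
qed

text \<open>The Peano form of the remainder, since second derivatives exist at \<open>u\<close>
  only. Along the segment to \<open>u + c\<close>, subtracting the quadratic polynomial leaves a
  function whose derivative is exactly the quantity bounded in
  \<open>derivative_increment_bound\<close>.\<close>

lemma taylor_second_order:
  fixes f :: "real^'n::finite \<Rightarrow> real"
  assumes f: "twice_diff_at u f"
  shows "((\<lambda>c. (f (u + c) - f u - frechet_derivative f (at u) c - second_derivative f u c c / 2)
      / (norm c)\<^sup>2) \<longlongrightarrow> 0) (at 0)"
proof (rule LIM_I)
  fix e :: real assume e: "e > 0"
  interpret Q: bounded_bilinear "second_derivative f u" by (rule second_derivative_bilinear[OF f])
  obtain d where d: "d > 0" "\<And>w. norm w < d \<Longrightarrow> f differentiable (at (u + w))"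
    "\<And>w c. norm w < d \<Longrightarrow> \<bar>frechet_derivative f (at (u + w)) c - frechet_derivative f (at u) c
        - second_derivative f u w c\<bar> \<le> e / 2 * norm w * norm c"
    using derivative_increment_bound[OF f, of "e / 2"] e by auto
  have bound: "\<bar>f (u + c) - f u - frechet_derivative f (at u) c - second_derivative f u c c / 2\<bar>
      \<le> e / 2 * (norm c)\<^sup>2" if c: "norm c < d" for c
  proof -
    define \<phi> where "\<phi> = (\<lambda>s. f (u + s *\<^sub>R c) - s * frechet_derivative f (at u) c - s\<^sup>2 * (second_derivative f u c c / 2))"
    have small: "norm (s *\<^sub>R c) < d" if "0 \<le> s" "s \<le> 1" for s :: real
      using that c mult_right_mono[OF that(2), of "norm c"] by simp
    have "\<exists>s\<in>{0<..<1}. \<phi> 1 - \<phi> 0 = (\<lambda>s r. r * (frechet_derivative f (at (u + s *\<^sub>R c)) c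
        - frechet_derivative f (at u) c - s * second_derivative f u c c)) s (1 - 0)"
    proof (rule mvt_simple)
      fix s :: real assume s: "0 \<le> s" "s \<le> 1"
      have D: "f differentiable (at (u + s *\<^sub>R c))" using d(2)[OF small] s by simp
      have "((\<lambda>s. f (u + s *\<^sub>R c)) has_derivative
          (\<lambda>r. frechet_derivative f (at (u + s *\<^sub>R c)) (r *\<^sub>R c))) (at s within {0..1})"
        using D[unfolded frechet_derivative_works]
        by (rule has_derivative_compose[rotated]) (auto intro!: derivative_eq_intros)
      then show "(\<phi> has_derivative (\<lambda>r. r * (frechet_derivative f (at (u + s *\<^sub>R c)) c
        - frechet_derivative f (at u) c - s * second_derivative f u c c))) (at s within {0..1})"
        unfolding \<phi>_def
        by (auto intro!: derivative_eq_intros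
            simp: linear_scale[OF linear_frechet_derivative[OF D]] algebra_simps)
    qed simp
    then obtain s where s: "0 < s" "s < 1" and "\<phi> 1 - \<phi> 0 = frechet_derivative f (at (u + s *\<^sub>R c)) c
        - frechet_derivative f (at u) c - second_derivative f u (s *\<^sub>R c) c"
      by (auto simp: Q.scaleR_left)
    then have "f (u + c) - f u - frechet_derivative f (at u) c - second_derivative f u c c / 2 =
        frechet_derivative f (at (u + s *\<^sub>R c)) c - frechet_derivative f (at u) c
          - second_derivative f u (s *\<^sub>R c) c"
      by (simp add: \<phi>_def)
    then have "\<bar>f (u + c) - f u - frechet_derivative f (at u) c - second_derivative f u c c / 2\<bar>
        \<le> e / 2 * norm (s *\<^sub>R c) * norm c"
      using d(3)[OF small[of s], of c] s by (simp only: less_imp_le)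
    also have "\<dots> \<le> e / 2 * norm c * norm c"
      using s e by (intro mult_right_mono mult_left_mono) (auto simp: mult_left_le_one_le)
    finally show ?thesis by (simp add: power2_eq_square)
  qed
  have "norm ((f (u + c) - f u - frechet_derivative f (at u) c - second_derivative f u c c / 2)
      / (norm c)\<^sup>2 - 0) < e" if "c \<noteq> 0" "norm c < d" for c
  proof -
    have "norm ((f (u + c) - f u - frechet_derivative f (at u) c - second_derivative f u c c / 2)
      / (norm c)\<^sup>2 - 0) \<le> e / 2"
      unfolding diff_0_right norm_divide real_norm_def
      using that(1) bound[OF that(2)] by (simp add: pos_divide_le_eq)
    then show ?thesis using e by linarith
  qed
  then show "\<exists>s>0. \<forall>c. c \<noteq> 0 \<and> norm (c - 0) < s \<longrightarrow>
      norm ((f (u + c) - f u - frechet_derivative f (at u) c - second_derivative f u c c / 2)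
      / (norm c)\<^sup>2 - 0) < e"
    using d(1) by auto
qed

text \<open>At a critical point the second derivative can be read off along any differentiable curve:
  a second derivative of the curve does not enter.\<close>

lemma second_derivative_along_curve:
  fixes f :: "real^'n::finite \<Rightarrow> real" and \<gamma> :: "real \<Rightarrow> real^'n"
  assumes f: "twice_diff_at u f" and crit: "\<And>c. frechet_derivative f (at u) c = 0"
    and \<gamma>: "(\<gamma> has_vector_derivative v) (at 0)" "\<gamma> 0 = u"
  shows "((\<lambda>t. (f (\<gamma> t) - f u) / t\<^sup>2) \<longlongrightarrow> second_derivative f u v v / 2) (at 0)"
proof -
  interpret Q: bounded_bilinear "second_derivative f u" by (rule second_derivative_bilinear[OF f])
  \<comment> \<open>Division by zero gives \<open>R 0 = 0\<close>, so the Taylor limit becomes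
    continuity of \<open>R\<close> at 0 and the curve may return to \<open>u\<close> at other
    times.\<close>
  define R where "R = (\<lambda>c. (f (u + c) - f u - second_derivative f u c c / 2) / (norm c)\<^sup>2)"
  have R: "isCont R 0"
    using taylor_second_order[OF f] by (simp add: isCont_def R_def crit Q.zero_left)
  define \<Delta> where "\<Delta> = (\<lambda>t. \<gamma> t - u)"
  have quot: "((\<lambda>t. \<Delta> t /\<^sub>R t) \<longlongrightarrow> v) (at 0)"
  proof -
    have "((\<lambda>t. norm (\<gamma> t - \<gamma> 0 - t *\<^sub>R v) / norm t) \<longlongrightarrow> 0) (at 0)"
      using \<gamma>(1) by (simp add: has_vector_derivative_def has_derivative_iff_norm)
    moreover have "norm (\<gamma> t - \<gamma> 0 - t *\<^sub>R v) / norm t = norm (\<Delta> t /\<^sub>R t - v)" if "t \<noteq> 0" for t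
    proof -
      have "\<gamma> t - \<gamma> 0 - t *\<^sub>R v = t *\<^sub>R (\<Delta> t /\<^sub>R t - v)"
        using that \<gamma>(2) by (simp add: \<Delta>_def scaleR_diff_right)
      then show ?thesis using that by simp
    qed
    ultimately have "((\<lambda>t. norm (\<Delta> t /\<^sub>R t - v)) \<longlongrightarrow> 0) (at 0)"
      by (subst LIM_equal[symmetric]) auto
    then show ?thesis by (rule LIM_zero_cancel[OF tendsto_norm_zero_cancel])
  qed
  have "isCont \<gamma> 0" using \<gamma>(1) by (rule has_vector_derivative_continuous)
  then have "(\<Delta> \<longlongrightarrow> 0) (at 0)"
    using \<gamma>(2) by (auto simp: \<Delta>_def isCont_def intro: LIM_zero)
  then have "((\<lambda>t. R (\<Delta> t)) \<longlongrightarrow> R 0) (at 0)"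
    using R isCont_tendsto_compose by blast
  then have "((\<lambda>t. R (\<Delta> t) * (norm (\<Delta> t /\<^sub>R t))\<^sup>2 + second_derivative f u (\<Delta> t /\<^sub>R t) (\<Delta> t /\<^sub>R t) / 2)
      \<longlongrightarrow> R 0 * (norm v)\<^sup>2 + second_derivative f u v v / 2) (at 0)" (is "(?E \<longlongrightarrow> _) _")
    by (intro tendsto_intros Q.tendsto quot) simp_all
  then have lim: "(?E \<longlongrightarrow> second_derivative f u v v / 2) (at 0)"
    by (simp only: R_def norm_zero power_zero_numeral div_by_0 mult_zero_left add_0_left)
  have eq: "?E t = (f (\<gamma> t) - f u) / t\<^sup>2" if "t \<noteq> 0" for t
  proof -
    have "R c * (norm c)\<^sup>2 = f (u + c) - f u - second_derivative f u c c / 2" for c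
      by (cases "c = 0") (simp_all add: R_def Q.zero_left)
    from this[of "\<Delta> t"] have "f (\<gamma> t) - f u = R (\<Delta> t) * (norm (\<Delta> t))\<^sup>2 + second_derivative f u (\<Delta> t) (\<Delta> t) / 2"
      by (simp add: \<Delta>_def)
    moreover have "(norm (\<Delta> t /\<^sub>R t))\<^sup>2 = (norm (\<Delta> t))\<^sup>2 / t\<^sup>2"
      by (simp add: power_mult_distrib power_inverse divide_inverse mult.commute)
    moreover have "second_derivative f u (\<Delta> t /\<^sub>R t) (\<Delta> t /\<^sub>R t) = second_derivative f u (\<Delta> t) (\<Delta> t) / t\<^sup>2"
      by (simp add: Q.scaleR_left Q.scaleR_right divide_inverse power2_eq_square mult.commute mult.left_commute)
    ultimately show ?thesis by (simp add: add_divide_distrib)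
  qed
  show ?thesis
    by (rule iffD1[OF LIM_equal lim]) (use eq in blast)
qed

section \<open>Spacelike hyperplanes in Minkowski space\<close>

lemma mink_inner: "mink X Y = fst X \<bullet> fst Y - snd X * snd Y"
  by (simp add: mink_def inner_vec_def)

lemma mink_commute: "mink X Y = mink Y X"
  by (simp add: mink_inner inner_commute mult.commute)

lemma mink_bilinear: "bounded_bilinear mink"
  unfolding bilinear_conv_bounded_bilinear[symmetric] bilinear_def
  by (auto simp: linear_iff mink_inner algebra_simps inner_add_left inner_add_right)

interpretation mink: bounded_bilinear mink
  by (rule mink_bilinear)

text \<open>\<open>D\<close> stands for the derivative of a chart at a point. Positivity makes it
  injective, so its range is a spacelike hyperplane.\<close>

context
  fixes D :: "real^'n::finite \<Rightarrow> 'n minkowski"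
  assumes lin: "linear D" and pos: "\<And>a. a \<noteq> 0 \<Longrightarrow> mink (D a) (D a) > 0"
begin

lemma mink_linear_image: "mink z (D b) = b \<bullet> (\<chi> k. mink z (D (axis k 1)))"
proof -
  have "b = (\<Sum>k\<in>UNIV. b $ k *\<^sub>R axis k 1)"
    using basis_expansion[of b] by (simp add: scalar_mult_eq_scaleR)
  then have "D b = D (\<Sum>k\<in>UNIV. b $ k *\<^sub>R axis k 1)" by simp
  also have "\<dots> = (\<Sum>k\<in>UNIV. b $ k *\<^sub>R D (axis k 1))"
    by (simp add: linear_sum[OF lin] linear_scale[OF lin])
  finally show ?thesis by (simp add: mink.sum_right mink.scaleR_right inner_vec_def)
qed

text \<open>Existence of the orthogonal projection \<open>D a\<close> of \<open>z\<close>: the Gram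
  map \<open>L\<close> is injective by positivity, hence onto.\<close>

lemma ex_mink_projection: "\<exists>a. \<forall>b. mink z (D b) = mink (D a) (D b)"
proof -
  define L where "L = (\<lambda>a. \<chi> k. mink (D a) (D (axis k 1)))"
  have "linear L"
    by (rule linearI) (simp_all add: L_def vec_eq_iff linear_add[OF lin] linear_scale[OF lin]
        mink.add_left mink.scaleR_left)
  moreover have "inj L"
    unfolding linear_injective_0[OF \<open>linear L\<close>]
    using pos mink_linear_image by (metis L_def inner_zero_right less_irrefl)
  ultimately obtain a where "L a = (\<chi> k. mink z (D (axis k 1)))"
    using linear_injective_imp_surjective by (metis surjD)
  then show ?thesis using mink_linear_image by (metis L_def)
qed

text \<open>Subtract from the time axis vector its projection. By Pythagoras the rest has square -1
  minus a nonnegative number, so it is timelike; its time component is then nonzero and a sign makes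
  it future directed.\<close>

lemma ex_unit_normal: "\<exists>\<nu>. (\<forall>a. mink \<nu> (D a) = 0) \<and> mink \<nu> \<nu> = -1 \<and> snd \<nu> > 0"
proof -
  define e :: "'n minkowski" where "e = (0, 1)"
  obtain a where a: "\<And>b. mink e (D b) = mink (D a) (D b)" using ex_mink_projection by blast
  define w where "w = e - D a"
  have orth: "mink w (D b) = 0" for b by (simp add: w_def mink.diff_left a)
  have "mink e e = mink (w + D a) (w + D a)" by (simp add: w_def)
  then have "-1 = mink w w + mink (D a) (D a)"
    using orth[of a] mink_commute[of w "D a"]
    by (simp add: mink.add_left mink.add_right) (simp add: e_def mink_inner)
  moreover have "mink (D a) (D a) \<ge> 0"
    using pos[of a] by (cases "a = 0") (auto simp: linear_0[OF lin] mink.zero_left)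
  ultimately have neg: "mink w w < 0" by linarith
  define s where "s = sqrt (- mink w w)"
  have s: "s > 0" "s\<^sup>2 = - mink w w" using neg by (auto simp: s_def)
  have "snd w \<noteq> 0"
  proof
    assume "snd w = 0"
    then have "mink w w = fst w \<bullet> fst w" by (simp add: mink_inner)
    then show False using neg inner_ge_zero[of "fst w"] by linarith
  qed
  then have "snd ((sgn (snd w) / s) *\<^sub>R w) > 0"
    using s by (simp add: sgn_if)
  moreover have "mink ((sgn (snd w) / s) *\<^sub>R w) ((sgn (snd w) / s) *\<^sub>R w) = - 1"
    using s neg \<open>snd w \<noteq> 0\<close> by (simp add: mink.scaleR_left mink.scaleR_right field_simps power2_eq_square sgn_if)
  moreover have "mink ((sgn (snd w) / s) *\<^sub>R w) (D b) = 0" for b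
    by (simp add: mink.scaleR_left orth)
  ultimately show ?thesis by blast
qed

context
  fixes \<nu> :: "'n minkowski"
  assumes orth: "\<And>a. mink \<nu> (D a) = 0" and unit: "mink \<nu> \<nu> = -1"
begin

lemma normal_decomposition: "\<exists>a c. z = D a + c *\<^sub>R \<nu>"
proof -
  \<comment> \<open>The pair (a, c) is itself read as an element of \<open>'n minkowski\<close>, so
    \<open>S\<close> is an endomorphism and injectivity yields surjectivity.\<close>
  define S where "S = (\<lambda>p::'n minkowski. D (fst p) + snd p *\<^sub>R \<nu>)"
  have S: "linear S"
    by (rule linearI) (simp_all add: S_def linear_add[OF lin] linear_scale[OF lin] algebra_simps)
  have "p = 0" if "S p = 0" for p
  proof -
    have "mink \<nu> (S p) = 0" using that by (simp add: mink.zero_right)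
    then have "snd p = 0" by (simp add: S_def mink.add_right mink.scaleR_right orth unit)
    moreover from this have "fst p = 0"
      using that pos[of "fst p"] by (auto simp: S_def mink.zero_left)
    ultimately show "p = 0" by (simp add: prod_eq_iff)
  qed
  then have "surj S"
    using linear_injective_imp_surjective[OF S] linear_injective_0[OF S] by blast
  then obtain p where "z = S p" by (rule surjE)
  then show ?thesis unfolding S_def by blast
qed

lemma unit_normal_unique:
  assumes "\<And>a. mink \<mu> (D a) = 0" "mink \<mu> \<mu> = -1" "snd \<mu> > 0" "snd \<nu> > 0"
  shows "\<mu> = \<nu>"
proof -
  obtain a c where ac: "\<mu> = D a + c *\<^sub>R \<nu>" using normal_decomposition by blast
  have "mink \<mu> (D a) = mink (D a) (D a)"
    by (simp add: ac mink.add_left mink.scaleR_left orth)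
  then have "a = 0" using assms(1) pos[of a] by auto
  then have \<mu>: "\<mu> = c *\<^sub>R \<nu>" using ac linear_0[OF lin] by simp
  then have "c\<^sup>2 = 1" using assms(2) unit by (simp add: mink.scaleR_left mink.scaleR_right power2_eq_square)
  moreover have "c > 0" using \<mu> assms(3,4) by (simp add: zero_less_mult_iff)
  ultimately show ?thesis using \<mu> by (simp add: power2_eq_1_iff)
qed

end
end

section \<open>Differentiability of chart transitions at one point\<close>

section \<open>Changes of parametrization\<close>

text \<open>A left inverse \<open>L\<close> of \<open>f'\<close> turns
  \<open>f (\<psi> z) = h z\<close> into an equation for the increment of \<psi>, with an error
  small relative to that increment. Continuity of \<psi> allows the error to be absorbed, which
  gives a Lipschitz bound; the bound in turn makes the error small relative to
  \<open>z - w\<close>.\<close>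

lemma has_derivative_lift:
  fixes f :: "'a::euclidean_space \<Rightarrow> 'b::euclidean_space" and h :: "'c::real_normed_vector \<Rightarrow> 'b"
  assumes f: "(f has_derivative f') (at (\<psi> w))" and inj: "inj f'"
    and cont: "isCont \<psi> w"
    and eq: "eventually (\<lambda>z. f (\<psi> z) = h z) (at w)" "f (\<psi> w) = h w"
    and h: "(h has_derivative h') (at w)"
  obtains J where "(\<psi> has_derivative J) (at w)" "\<And>v. f' (J v) = h' v"
proof -
  have lin: "linear f'" using f has_derivative_linear by blast
  obtain L where L: "linear L" "L \<circ> f' = id"
    using linear_injective_left_inverse[OF lin inj] by blast
  then have Lf: "L (f' a) = a" for a by (metis comp_apply id_apply)
  obtain C where C: "C > 0" "\<And>z. norm (L z) \<le> C * norm z"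
    using linear_bounded_pos[OF L(1)] by blast
  have bl: "bounded_linear h'" using h has_derivative_bounded_linear by blast
  obtain K where K: "K > 0" "\<And>z. norm (h' z) \<le> norm z * K"
    using bounded_linear.pos_bounded[OF bl] by blast
  let ?\<Delta> = "\<lambda>z. \<psi> z - \<psi> w"
  have ev_f: "eventually (\<lambda>z. norm (h z - h w - f' (?\<Delta> z)) \<le> e * norm (?\<Delta> z)) (at w)" if "e > 0" for e
  proof -
    obtain d where d: "d > 0" "\<And>y. norm (y - \<psi> w) < d \<Longrightarrow> norm (f y - f (\<psi> w) - f' (y - \<psi> w)) \<le> e * norm (y - \<psi> w)"
      using f \<open>e > 0\<close> unfolding has_derivative_at_alt by blast
    have "eventually (\<lambda>z. dist (\<psi> z) (\<psi> w) < d) (at w)"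
      using cont d(1) unfolding isCont_def by (rule tendstoD)
    with eq(1) show ?thesis
    proof eventually_elim
      case (elim z)
      then show ?case using d(2)[of "\<psi> z"] eq(2) by (simp add: dist_norm)
    qed
  qed
  have ev_h: "eventually (\<lambda>z. norm (h z - h w - h' (z - w)) \<le> e * norm (z - w)) (at w)" if "e > 0" for e
    using h that unfolding has_derivative_within_alt2 by blast
  \<comment> \<open>With tolerance 1 / (2C) the error contributes half the increment; moving it to
    the left doubles the factor C (K + 1).\<close>
  define A where "A = 2 * C * (K + 1)"
  have A: "A > 0" using C K by (simp add: A_def)
  have lip: "eventually (\<lambda>z. norm (?\<Delta> z) \<le> A * norm (z - w)) (at w)"
  proof -
    have "1 / (2 * C) > 0" using C by simp
    from ev_f[OF this] ev_h[OF zero_less_one] show ?thesis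
    proof eventually_elim
      case (elim z)
      have "norm (?\<Delta> z) = norm (L (f' (?\<Delta> z)))" by (simp add: Lf)
      also have "\<dots> \<le> C * norm (f' (?\<Delta> z))" by (rule C)
      also have "norm (f' (?\<Delta> z)) \<le> norm (h z - h w) + norm (h z - h w - f' (?\<Delta> z))"
        by (metis norm_triangle_sub norm_minus_commute add.commute)
      also have "norm (h z - h w) \<le> norm (h' (z - w)) + norm (h z - h w - h' (z - w))"
        by (rule norm_triangle_sub)
      finally have "norm (?\<Delta> z) \<le> C * ((norm (h' (z - w)) + norm (h z - h w - h' (z - w))) + norm (h z - h w - f' (?\<Delta> z)))"
        using C(1) by (simp add: mult_left_mono)
      also have "\<dots> \<le> C * ((K * norm (z - w) + norm (z - w)) + norm (?\<Delta> z) / (2 * C))"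
        using elim K(2)[of "z - w"] C(1) by (intro mult_left_mono add_mono) (auto simp: mult.commute)
      also have "\<dots> = C * (K + 1) * norm (z - w) + norm (?\<Delta> z) / 2"
        using C(1) by (simp add: algebra_simps)
      finally show ?case by (simp add: A_def)
    qed
  qed
  have D: "(\<psi> has_derivative (\<lambda>v. L (h' v))) (at w)"
    unfolding has_derivative_within_alt2
  proof (intro conjI allI impI)
    show "bounded_linear (\<lambda>v. L (h' v))"
      using L(1) by (intro bounded_linear_compose[OF _ bl]) (simp add: linear_conv_bounded_linear)
    fix e :: real assume e: "e > 0"
    \<comment> \<open>After the Lipschitz factor \<open>A\<close> and the norm bound
      \<open>C\<close> of \<open>L\<close>, each of the two errors accounts for half of
      \<open>e\<close>.\<close>
    have "e / (2 * C * A) > 0" "e / (2 * C) > 0" using e C A by auto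
    from ev_f[OF this(1)] ev_h[OF this(2)] lip
    show "eventually (\<lambda>z. norm (\<psi> z - \<psi> w - L (h' (z - w))) \<le> e * norm (z - w)) (at w)"
    proof eventually_elim
      case (elim z)
      have "\<psi> z - \<psi> w - L (h' (z - w)) = L (f' (?\<Delta> z) - h' (z - w))"
        by (simp add: linear_diff[OF L(1)] Lf)
      also have "norm \<dots> \<le> C * norm (f' (?\<Delta> z) - h' (z - w))" by (rule C)
      also have "norm (f' (?\<Delta> z) - h' (z - w)) \<le> norm (h z - h w - f' (?\<Delta> z)) + norm (h z - h w - h' (z - w))"
        using norm_triangle_ineq4[of "h z - h w - h' (z - w)" "h z - h w - f' (?\<Delta> z)"] by simp
      also have "\<dots> \<le> e / (2 * C * A) * (A * norm (z - w)) + e / (2 * C) * norm (z - w)"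
        using elim e C A
        by (intro add_mono order_trans[OF elim(1)] mult_left_mono) auto
      also have "\<dots> = e * norm (z - w) / C" using A C by (simp add: field_simps)
      finally show ?case using C(1) by (simp add: mult_left_mono)
    qed
  qed
  \<comment> \<open>\<open>L\<close> is only a left inverse. That \<open>f'\<close> undoes it on the
    range of \<open>h'\<close> follows from uniqueness of the derivative of the composition.\<close>
  have "((\<lambda>z. f (\<psi> z)) has_derivative (\<lambda>v. f' (L (h' v)))) (at w)"
    by (rule has_derivative_compose[OF D f])
  moreover have "((\<lambda>z. f (\<psi> z)) has_derivative h') (at w)"
    using h eq by (rule_tac has_derivative_transform_eventually[of h]) (auto elim: eventually_mono)
  ultimately have "(\<lambda>v. f' (L (h' v))) = h'" by (rule has_derivative_unique)
  then show thesis using that[OF D] by metis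
qed

section \<open>Fundamental forms and local parametrizations\<close>

lemma smooth_on_differentiable: "smooth_on W f \<Longrightarrow> u \<in> W \<Longrightarrow> f differentiable (at u)"
  unfolding smooth_on_def using Ck_on.simps(2) by blast

lemma smooth_on_continuous: "smooth_on W f \<Longrightarrow> continuous_on W f"
  unfolding smooth_on_def using Ck_on.simps(1) by blast

lemma smooth_on_partial_deriv: "smooth_on W f \<Longrightarrow> smooth_on W (partial_deriv i f)"
  unfolding smooth_on_def using Ck_on.simps(2) by blast

lemma smooth_on_twice_diff:
  assumes "smooth_on W f" "open W" "u \<in> W"
  shows "twice_diff_at u f"
  using assms smooth_on_differentiable smooth_on_partial_deriv unfolding twice_diff_at_def by blast

lemma local_paramD:
  assumes "local_param M W x"
  shows "open W" "smooth_on W x" "openin (top_of_set M) (x ` W)" "x ` W \<subseteq> M"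
    "\<exists>g. homeomorphism W (x ` W) x g"
    "\<And>u. u \<in> W \<Longrightarrow> inj (frechet_derivative x (at u))"
    "\<And>u. u \<in> W \<Longrightarrow> (x has_derivative frechet_derivative x (at u)) (at u)"
  using assms openin_imp_subset smooth_on_differentiable
  unfolding local_param_def frechet_derivative_works[symmetric] by blast+

text \<open>The transition is \<open>g\<close> after \<open>y\<close> with \<open>g\<close> the
  continuous inverse of \<open>x\<close>; it is defined near \<open>w\<close> because chart images
  are relatively open. Immersivity of \<open>x\<close> then gives differentiability through
  \<open>has_derivative_lift\<close>.\<close>

lemma chart_transition:
  fixes M :: "'n::finite minkowski set"
  assumes x: "local_param M W x" and y: "local_param M V y" and u: "u \<in> W" and w: "w \<in> V"
    and p: "x u = y w"
  obtains \<psi> J where "(\<psi> has_derivative J) (at w)" "\<psi> w = u"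
    "eventually (\<lambda>z. x (\<psi> z) = y z) (at w)"
    "\<And>v. frechet_derivative x (at u) (J v) = frechet_derivative y (at w) v"
proof -
  obtain g where g: "homeomorphism W (x ` W) x g" using local_paramD(5)[OF x] by blast
  define V0 where "V0 = V \<inter> y -` (x ` W)"
  have "openin (top_of_set V) V0"
    unfolding V0_def using local_paramD(3)[OF x] local_paramD(4)[OF y]
    by (intro continuous_openin_preimage[OF smooth_on_continuous[OF local_paramD(2)[OF y]]]) auto
  then have V0: "open V0" using local_paramD(1)[OF y] openin_open_trans by blast
  have w0: "w \<in> V0" using u w unfolding V0_def by (simp flip: p)
  have gu: "g (y w) = u" using g u p by (metis homeomorphism_apply1)
  have xg: "x (g (y z)) = y z" if "z \<in> V0" for z
    using that g by (auto simp: V0_def homeomorphism_apply2)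
  have "continuous_on V0 (\<lambda>z. g (y z))"
  proof (rule continuous_on_compose2[of "x ` W" g])
    show "continuous_on (x ` W) g" using g by (simp add: homeomorphism_def)
    show "continuous_on V0 y"
      using smooth_on_continuous[OF local_paramD(2)[OF y]] by (rule continuous_on_subset) (auto simp: V0_def)
  qed (auto simp: V0_def)
  then have cont: "isCont (\<lambda>z. g (y z)) w" using V0 w0 continuous_on_eq_continuous_at by blast
  have ev: "eventually (\<lambda>z. x (g (y z)) = y z) (at w)"
    using eventually_at_in_open'[OF V0 w0] by eventually_elim (rule xg)
  have dx: "(x has_derivative frechet_derivative x (at u)) (at (g (y w)))"
    using local_paramD(7)[OF x u] by (simp add: gu)
  show thesis
    by (rule has_derivative_lift[of x _ "\<lambda>z. g (y z)", OF dx local_paramD(6)[OF x u] cont ev xg[OF w0]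
          local_paramD(7)[OF y w]]) (rule that[OF _ gu ev])
qed

text \<open>The definition collects vectors from all charts; the derivative \<open>J\<close> of the
  transition carries those of any other chart into the range for this one.\<close>

lemma tangent_space_eq:
  assumes x: "local_param M W x" and u: "u \<in> W"
  shows "tangent_space M (x u) = range (frechet_derivative x (at u))"
proof
  show "range (frechet_derivative x (at u)) \<subseteq> tangent_space M (x u)"
    unfolding tangent_space_def using x u by blast
  show "tangent_space M (x u) \<subseteq> range (frechet_derivative x (at u))"
  proof
    fix v assume "v \<in> tangent_space M (x u)"
    then obtain V y w a where y: "local_param M V y" "w \<in> V" "y w = x u"
      and v: "v = frechet_derivative y (at w) a"
      unfolding tangent_space_def by blast
    from chart_transition[OF x y(1) u y(2) y(3)[symmetric]] obtain J
      where "\<And>a. frechet_derivative x (at u) (J a) = frechet_derivative y (at w) a" by metis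
    then show "v \<in> range (frechet_derivative x (at u))" using v by (metis rangeI)
  qed
qed

lemma linear_chart_derivative:
  "local_param M W x \<Longrightarrow> u \<in> W \<Longrightarrow> linear (frechet_derivative x (at u))"
  using local_paramD(7) has_derivative_linear by blast

lemma spacelike_chart_derivative:
  assumes "spacelike M" and x: "local_param M W x" "u \<in> W" and "a \<noteq> 0"
  shows "mink (frechet_derivative x (at u) a) (frechet_derivative x (at u) a) > 0"
proof -
  have "x u \<in> M" using local_paramD(4)[OF x(1)] x(2) by blast
  moreover have "frechet_derivative x (at u) a \<in> tangent_space M (x u)"
    unfolding tangent_space_eq[OF x] by blast
  moreover have "frechet_derivative x (at u) a \<noteq> 0"
    using local_paramD(6)[OF x] \<open>a \<noteq> 0\<close> linear_injective_0[OF linear_chart_derivative[OF x]] by blast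
  ultimately show ?thesis using \<open>spacelike M\<close> unfolding spacelike_def by blast
qed

lemma unit_normal_properties:
  assumes M: "spacelike M" and x: "local_param M W x" "u \<in> W"
  shows "mink (unit_normal M (x u)) (frechet_derivative x (at u) a) = 0"
    and "mink (unit_normal M (x u)) (unit_normal M (x u)) = -1"
proof -
  note lin = linear_chart_derivative[OF x] and pos = spacelike_chart_derivative[OF M x]
  obtain n where n: "\<And>a. mink n (frechet_derivative x (at u) a) = 0" "mink n n = -1" "snd n > 0"
    using ex_unit_normal[OF lin pos] by blast
  have "unit_normal M (x u) = n"
    unfolding unit_normal_def tangent_space_eq[OF x]
    using n by (intro the_equality) (auto intro: unit_normal_unique[OF lin pos])
  with n show "mink (unit_normal M (x u)) (frechet_derivative x (at u) a) = 0"
    "mink (unit_normal M (x u)) (unit_normal M (x u)) = -1" by auto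
qed

lemma first_ff_inner:
  assumes "x differentiable (at u)"
  shows "v \<bullet> (first_ff x u *v w) = mink (frechet_derivative x (at u) v) (frechet_derivative x (at u) w)"
  by (simp add: frechet_derivative_sum_partial_deriv[OF assms] mink.sum_left mink.sum_right
      mink.scaleR_left mink.scaleR_right first_ff_def matrix_vector_mult_def inner_vec_def sum_distrib_left mult.commute
      mult.left_commute) (rule sum.swap)

lemma first_ff_symmetric: "transpose (first_ff x u) = first_ff x u"
  by (simp add: transpose_def first_ff_def vec_eq_iff mink_commute)

lemma first_ff_pos_def:
  assumes "spacelike M" and x: "local_param M W x" "u \<in> W"
  shows "pos_def (first_ff x u)"
  unfolding pos_def_def
  using spacelike_chart_derivative[OF assms] smooth_on_differentiable[OF local_paramD(2)[OF x(1)] x(2)]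
  by (simp add: first_ff_inner)

text \<open>The Christoffel terms are tangential and vanish against the normal, so \<open>h\<close>
  involves plain second partials only.\<close>

lemma second_ff_entry:
  assumes "spacelike M" and x: "local_param M W x" "u \<in> W"
  shows "second_ff M x u $ i $ j = - mink (partial_deriv i (partial_deriv j x) u) (unit_normal M (x u))"
proof -
  have "mink (partial_deriv k x u) (unit_normal M (x u)) = 0" for k
    using unit_normal_properties(1)[OF assms] by (simp add: partial_deriv_def mink_commute)
  then show ?thesis
    by (simp add: second_ff_def cov_hessian_def mink.diff_left mink.sum_left mink.scaleR_left)
qed

lemma second_ff_symmetric:
  assumes "spacelike M" and x: "local_param M W x" "u \<in> W"
  shows "transpose (second_ff M x u) = second_ff M x u"
  using partial_deriv_commute[OF smooth_on_twice_diff[OF local_paramD(2,1)[OF x(1)] x(2)]]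
  by (simp add: transpose_def vec_eq_iff second_ff_entry[OF assms])

text \<open>With the normal frozen at \<open>x u\<close>, the height function \<open>F\<close> has a
  critical point at \<open>u\<close> and its Hessian there is \<open>-h\<close>. At a critical point
  the velocity of the curve is enough.\<close>

lemma second_ff_along_curve:
  fixes \<gamma> :: "real \<Rightarrow> real^'n::finite"
  assumes M: "spacelike M" and x: "local_param M W x" "u \<in> W"
    and \<gamma>: "(\<gamma> has_vector_derivative v) (at 0)" "\<gamma> 0 = u"
  shows "((\<lambda>t. mink (x (\<gamma> t) - x u) (unit_normal M (x u)) / t\<^sup>2)
    \<longlongrightarrow> - (v \<bullet> (second_ff M x u *v v)) / 2) (at 0)"
proof -
  define n where "n = unit_normal M (x u)"
  define F where "F = (\<lambda>z. mink (x z) n)"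
  note W = local_paramD(1)[OF x(1)] and sm = local_paramD(2)[OF x(1)]
  have bl: "bounded_linear (\<lambda>z. mink z n)" by (rule mink.bounded_linear_left)
  have DF: "(F has_derivative (\<lambda>h. mink (frechet_derivative x (at z) h) n)) (at z)" if "z \<in> W" for z
    unfolding F_def by (rule bounded_linear.has_derivative[OF bl local_paramD(7)[OF x(1) that]])
  have pF: "partial_deriv i F z = mink (partial_deriv i x z) n" if "z \<in> W" for i z
    unfolding F_def by (rule partial_deriv_bounded_linear[OF bl smooth_on_differentiable[OF sm that]])
  have dp: "partial_deriv i x differentiable (at u)" for i
    using smooth_on_differentiable[OF smooth_on_partial_deriv[OF sm] x(2)] .
  have DpF: "(partial_deriv i F has_derivative (\<lambda>h. mink (frechet_derivative (partial_deriv i x) (at u) h) n)) (at u)" for i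
  proof (rule has_derivative_transform_within_open[OF _ W x(2)])
    show "((\<lambda>z. mink (partial_deriv i x z) n) has_derivative
        (\<lambda>h. mink (frechet_derivative (partial_deriv i x) (at u) h) n)) (at u)"
      by (rule bounded_linear.has_derivative[OF bl dp[unfolded frechet_derivative_works]])
  qed (simp add: pF)
  have twice: "twice_diff_at u F"
    unfolding twice_diff_at_def using W x(2) DF DpF differentiableI by blast
  have crit: "frechet_derivative F (at u) c = 0" for c
    using frechet_derivative_at[OF DF[OF x(2)]] unit_normal_properties(1)[OF M x]
    by (metis mink_commute n_def)
  have "second_derivative F u v v = - (v \<bullet> (second_ff M x u *v v))"
  proof -
    have "second_derivative F u v v = (\<Sum>j\<in>UNIV. v $ j * mink (frechet_derivative (partial_deriv j x) (at u) v) n)"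
      by (simp add: second_derivative_def frechet_derivative_at[OF DpF, symmetric])
    also have "\<dots> = (\<Sum>j\<in>UNIV. \<Sum>i\<in>UNIV. v $ j * (v $ i * mink (partial_deriv i (partial_deriv j x) u) n))"
      by (simp add: frechet_derivative_sum_partial_deriv[OF dp] mink.sum_left mink.scaleR_left sum_distrib_left)
    also have "\<dots> = (\<Sum>i\<in>UNIV. \<Sum>j\<in>UNIV. v $ j * (v $ i * mink (partial_deriv i (partial_deriv j x) u) n))"
      by (rule sum.swap)
    also have "\<dots> = - (v \<bullet> (second_ff M x u *v v))"
      by (simp add: inner_vec_def matrix_vector_mult_def second_ff_entry[OF M x] n_def sum_distrib_left
          sum_negf mult.commute mult.left_commute)
    finally show ?thesis .
  qed
  then show ?thesis
    using second_derivative_along_curve[OF twice crit \<gamma>] by (simp add: F_def n_def mink.diff_left)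
qed

lemma quadratic_form_congruence:
  fixes A J :: "real^'n^'n::finite"
  shows "v \<bullet> ((transpose J ** A ** J) *v v) = (J *v v) \<bullet> (A *v (J *v v))"
proof -
  have "v \<bullet> ((transpose J ** A ** J) *v v) = v \<bullet> (transpose J *v (A *v (J *v v)))"
    by (simp only: matrix_vector_mul_assoc matrix_mul_assoc)
  also have "\<dots> = (J *v v) \<bullet> (A *v (J *v v))"
    by (metis dot_lmul_matrix inner_commute transpose_matrix_vector)
  finally show ?thesis .
qed

lemma congruence_symmetric:
  fixes A J :: "real^'n^'n::finite"
  assumes "transpose A = A"
  shows "transpose (transpose J ** A ** J) = transpose J ** A ** J"
  by (simp add: matrix_transpose_mul assms matrix_mul_assoc)

text \<open>The second fundamental form at \<open>p\<close> is, up to the factor \<open>-1/2\<close>, the second order part of the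
  height over the tangent plane, hence transforms as a quadratic form under a change of chart that
  is merely known to be differentiable at the point.\<close>

lemma rel_eigenvalues_chart_independent:
  fixes M :: "'n::finite minkowski set"
  assumes M: "spacelike M" and x: "local_param M W x" "u \<in> W" and y: "local_param M V y" "w \<in> V"
    and p: "x u = y w"
  shows "rel_eigenvalues (second_ff M y w) (first_ff y w) = rel_eigenvalues (second_ff M x u) (first_ff x u)"
proof -
  obtain \<psi> J where \<psi>: "(\<psi> has_derivative J) (at w)" "\<psi> w = u"
    and ev: "eventually (\<lambda>z. x (\<psi> z) = y z) (at w)"
    and DJ: "\<And>v. frechet_derivative x (at u) (J v) = frechet_derivative y (at w) v"
    using chart_transition[OF x(1) y(1) x(2) y(2) p] by blast
  define A where "A = matrix J"
  have linJ: "linear J" using \<psi>(1) has_derivative_linear by blast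
  have J: "J v = A *v v" for v using fun_cong[OF matrix_vector_mul(2)[OF linJ], of v] by (simp add: A_def)
  have injy: "v = 0" if "frechet_derivative y (at w) v = 0" for v
    using that local_paramD(6)[OF y] linear_injective_0[OF linear_chart_derivative[OF y]] by blast
  have "inj J"
    unfolding linear_injective_0[OF linJ]
    using injy DJ linear_0[OF linear_chart_derivative[OF x]] by metis
  then have det: "det A \<noteq> 0" using det_nz_iff_inj[OF linJ] by (simp add: A_def)
  have dx: "x differentiable (at u)" and dy: "y differentiable (at w)"
    using smooth_on_differentiable local_paramD(2) x y by blast+
  have first: "first_ff y w = transpose A ** first_ff x u ** A"
  proof (rule symmetric_matrix_eqI[OF first_ff_symmetric congruence_symmetric[OF first_ff_symmetric]])
    show "v \<bullet> (first_ff y w *v v) = v \<bullet> ((transpose A ** first_ff x u ** A) *v v)" for v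
      unfolding quadratic_form_congruence first_ff_inner[OF dx] first_ff_inner[OF dy] DJ[symmetric] J ..
  qed
  have second: "second_ff M y w = transpose A ** second_ff M x u ** A"
  proof (rule symmetric_matrix_eqI[OF second_ff_symmetric[OF M y] congruence_symmetric[OF second_ff_symmetric[OF M x]]])
    fix v :: "real^'n"
    define n where "n = unit_normal M (x u)"
    have line: "((\<lambda>t. w + t *\<^sub>R v) has_vector_derivative v) (at 0)"
      by (auto intro!: derivative_eq_intros simp: has_vector_derivative_def)
    \<comment> \<open>A line in the chart \<open>y\<close> becomes a curve in the chart
      \<open>x\<close> with velocity \<open>J v\<close>; nothing is known about its second
      derivative.\<close>
    have "((\<lambda>t. \<psi> (w + t *\<^sub>R v)) has_derivative (\<lambda>t. J (t *\<^sub>R v))) (at 0)"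
    proof (rule has_derivative_compose[where f = "\<lambda>t. w + t *\<^sub>R v" and f' = "\<lambda>t. t *\<^sub>R v"])
      show "((\<lambda>t. w + t *\<^sub>R v) has_derivative (\<lambda>t. t *\<^sub>R v)) (at 0)"
        using line by (simp add: has_vector_derivative_def)
      show "(\<psi> has_derivative J) (at (w + 0 *\<^sub>R v))" using \<psi>(1) by simp
    qed
    then have "((\<lambda>t. \<psi> (w + t *\<^sub>R v)) has_vector_derivative J v) (at 0)"
      by (simp add: has_vector_derivative_def linear_scale[OF linJ])
    from second_ff_along_curve[OF M x this]
    have "((\<lambda>t. mink (x (\<psi> (w + t *\<^sub>R v)) - x u) n / t\<^sup>2)
        \<longlongrightarrow> - (J v \<bullet> (second_ff M x u *v J v)) / 2) (at 0)"
      by (simp add: \<psi>(2) n_def)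
    moreover have "eventually (\<lambda>t. mink (x (\<psi> (w + t *\<^sub>R v)) - x u) n / t\<^sup>2 = mink (y (w + t *\<^sub>R v) - y w) n / t\<^sup>2) (at 0)"
    proof -
      have "eventually (\<lambda>z. x (\<psi> z) = y z) (nhds w)"
        using ev \<psi>(2) p by (auto simp: eventually_at_filter elim: eventually_mono)
      moreover have "((\<lambda>t. w + t *\<^sub>R v) \<longlongrightarrow> w) (at 0)"
        by (auto intro!: tendsto_eq_intros)
      ultimately have "eventually (\<lambda>t. x (\<psi> (w + t *\<^sub>R v)) = y (w + t *\<^sub>R v)) (at 0)"
        by (auto simp: filterlim_iff)
      then show ?thesis by eventually_elim (simp add: p)
    qed
    ultimately have "((\<lambda>t. mink (y (w + t *\<^sub>R v) - y w) n / t\<^sup>2)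
        \<longlongrightarrow> - (J v \<bullet> (second_ff M x u *v J v)) / 2) (at 0)"
      by (rule Lim_transform_eventually)
    moreover have "((\<lambda>t. mink (y (w + t *\<^sub>R v) - y w) n / t\<^sup>2)
        \<longlongrightarrow> - (v \<bullet> (second_ff M y w *v v)) / 2) (at 0)"
      using second_ff_along_curve[OF M y line] by (simp add: n_def p)
    ultimately have "- (J v \<bullet> (second_ff M x u *v J v)) / 2 = - (v \<bullet> (second_ff M y w *v v)) / 2"
      by (rule tendsto_unique[OF at_neq_bot])
    then show "v \<bullet> (second_ff M y w *v v) = v \<bullet> ((transpose A ** second_ff M x u ** A) *v v)"
      by (simp add: quadratic_form_congruence J)
  qed
  show ?thesis unfolding first second by (rule rel_eigenvalues_congruence[OF det])
qed

section \<open>Principal curvatures and convexity read in one chart\<close>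

lemma principal_curvatures_eq:
  assumes M: "spacelike M" and x: "local_param M W x" "u \<in> W"
  shows "principal_curvatures M (x u) = rel_eigenvalues (second_ff M x u) (first_ff x u)"
  unfolding principal_curvatures_def
proof (rule the_equality)
  show "\<exists>V y w. local_param M V y \<and> w \<in> V \<and> y w = x u \<and>
      rel_eigenvalues (second_ff M x u) (first_ff x u) = rel_eigenvalues (second_ff M y w) (first_ff y w)"
    using x by blast
next
  fix \<kappa>
  assume "\<exists>V y w. local_param M V y \<and> w \<in> V \<and> y w = x u \<and> \<kappa> = rel_eigenvalues (second_ff M y w) (first_ff y w)"
  then show "\<kappa> = rel_eigenvalues (second_ff M x u) (first_ff x u)"
    using rel_eigenvalues_chart_independent[OF M x] by metis
qed

lemma strictly_convex_second_ff_pos_def: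
  assumes M: "spacelike M" "strictly_convex M" and x: "local_param M W x" "u \<in> W"
  shows "pos_def (second_ff M x u)"
proof (rule pos_def_if_rel_eigenvalues_pos[OF first_ff_pos_def[OF M(1) x] first_ff_symmetric second_ff_symmetric[OF M(1) x]])
  fix \<kappa> assume "\<kappa> \<in> set (rel_eigenvalues (second_ff M x u) (first_ff x u))"
  moreover have "x u \<in> M" using local_paramD(4)[OF x(1)] x(2) by blast
  ultimately show "\<kappa> > 0"
    using M(2) by (simp add: strictly_convex_def principal_curvatures_eq[OF M(1) x])
qed

section \<open>The Gauss equation\<close>

text \<open>The Christoffel symbols of the first kind. By the product rule the right side has six
  terms, and symmetry of second partials cancels four of them.\<close>

lemma mink_second_partial_deriv_first_ff:
  assumes sm: "smooth_on W x" and W: "open W" "u \<in> W"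
  shows "2 * mink (partial_deriv i (partial_deriv j x) u) (partial_deriv k x u) =
    partial_deriv i (\<lambda>w. first_ff x w $ j $ k) u + partial_deriv j (\<lambda>w. first_ff x w $ i $ k) u
      - partial_deriv k (\<lambda>w. first_ff x w $ i $ j) u"
proof -
  have d: "partial_deriv l x differentiable (at u)" for l
    using smooth_on_differentiable[OF smooth_on_partial_deriv[OF sm] W(2)] .
  have p: "partial_deriv l (\<lambda>w. first_ff x w $ i $ j) u =
      mink (partial_deriv l (partial_deriv i x) u) (partial_deriv j x u)
      + mink (partial_deriv i x u) (partial_deriv l (partial_deriv j x) u)" for l i j
    by (simp add: first_ff_def partial_deriv_bilinear[OF mink_bilinear d d])
  note comm = partial_deriv_commute[OF smooth_on_twice_diff[OF sm W]]
  show ?thesis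
    unfolding p comm[of j i] comm[of k i] comm[of k j]
    by (simp add: mink_commute)
qed

text \<open>The third derivatives cancel because \<open>\<partial>\<^sub>l \<partial>\<^sub>i\<close> is symmetric; the right hand side depends
  on the metric alone by the preceding lemma.\<close>

lemma mink_second_derivatives:
  assumes sm: "smooth_on W x" and W: "open W" "u \<in> W"
  shows "mink (partial_deriv i (partial_deriv j x) u) (partial_deriv l (partial_deriv k x) u)
      - mink (partial_deriv l (partial_deriv j x) u) (partial_deriv i (partial_deriv k x) u) =
    partial_deriv l (\<lambda>w. mink (partial_deriv i (partial_deriv j x) w) (partial_deriv k x w)) u
      - partial_deriv i (\<lambda>w. mink (partial_deriv l (partial_deriv j x) w) (partial_deriv k x w)) u"
proof -
  have d1: "partial_deriv a x differentiable (at u)" for a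
    using smooth_on_differentiable[OF smooth_on_partial_deriv[OF sm] W(2)] .
  have d2: "partial_deriv a (partial_deriv b x) differentiable (at u)" for a b
    using smooth_on_differentiable[OF smooth_on_partial_deriv[OF smooth_on_partial_deriv[OF sm]] W(2)] .
  show ?thesis
    unfolding partial_deriv_bilinear[OF mink_bilinear d2 d1]
      partial_deriv_commute[OF smooth_on_twice_diff[OF smooth_on_partial_deriv[OF sm] W], of l i j]
    by simp
qed

text \<open>The Gauss formula: tangential part given by \<open>a i j\<close>, normal coefficient
  \<open>h\<close> itself. The minus sign in the second equation is the square -1 of the
  normal.\<close>

lemma second_derivative_decomposition:
  fixes M :: "'n::finite minkowski set"
  assumes M: "spacelike M" and x: "local_param M W x" "u \<in> W"
  obtains a :: "'n \<Rightarrow> 'n \<Rightarrow> real^'n" where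
    "\<And>i j k. mink (partial_deriv i (partial_deriv j x) u) (partial_deriv k x u) = (first_ff x u *v a i j) $ k"
    "\<And>i j l k. mink (partial_deriv i (partial_deriv j x) u) (partial_deriv l (partial_deriv k x) u)
      = a i j \<bullet> (first_ff x u *v a l k) - second_ff M x u $ i $ j * second_ff M x u $ l $ k"
proof -
  define D where "D = frechet_derivative x (at u)"
  define n where "n = unit_normal M (x u)"
  have lin: "linear D" unfolding D_def by (rule linear_chart_derivative[OF x])
  have pos: "mink (D a) (D a) > 0" if "a \<noteq> 0" for a
    unfolding D_def by (rule spacelike_chart_derivative[OF M x that])
  have n: "mink n (D a) = 0" "mink n n = -1" for a
    unfolding D_def n_def by (rule unit_normal_properties[OF M x])+
  have n': "mink (D a) n = 0" for a using n(1) mink_commute by metis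
  have inner: "mink (D v) (D w) = v \<bullet> (first_ff x u *v w)" for v w
    unfolding D_def
    by (rule first_ff_inner[symmetric]) (rule smooth_on_differentiable[OF local_paramD(2)[OF x(1)] x(2)])
  have "\<exists>a c. partial_deriv i (partial_deriv j x) u = D a + c *\<^sub>R n" for i j
    by (rule normal_decomposition[OF lin pos n])
  then obtain a c where ac: "\<And>i j. partial_deriv i (partial_deriv j x) u = D (a i j) + c i j *\<^sub>R n"
    by metis
  have c: "second_ff M x u $ i $ j = c i j" for i j
    unfolding second_ff_entry[OF M x] n_def[symmetric] ac
    by (simp add: mink.add_left mink.scaleR_left n' n(2))
  have 1: "mink (partial_deriv i (partial_deriv j x) u) (partial_deriv k x u) = (first_ff x u *v a i j) $ k" for i j k
  proof -
    have "mink (partial_deriv i (partial_deriv j x) u) (partial_deriv k x u) = mink (D (a i j)) (D (axis k 1))"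
      unfolding ac partial_deriv_def[of k x u] D_def[symmetric]
      by (simp add: mink.add_left mink.scaleR_left n(1))
    also have "\<dots> = mink (D (axis k 1)) (D (a i j))" by (rule mink_commute)
    finally show ?thesis by (simp add: inner inner_axis')
  qed
  have 2: "mink (partial_deriv i (partial_deriv j x) u) (partial_deriv l (partial_deriv k x) u)
      = a i j \<bullet> (first_ff x u *v a l k) - second_ff M x u $ i $ j * second_ff M x u $ l $ k" for i j l k
    unfolding ac c
    by (simp add: mink.add_left mink.add_right mink.scaleR_left mink.scaleR_right n n' inner)
  show thesis by (rule that[of a]) (rule 1 2)+
qed

text \<open>The metric determines the products with first partials, hence, the metric being
  nondegenerate, the tangential parts \<open>a\<close> and \<open>b\<close> agree. Cancelling them
  in the Gauss equation leaves the minors. Equality of the metrics is needed near \<open>u\<close>,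
  since it is differentiated twice.\<close>

lemma second_ff_minors_intrinsic:
  fixes M M' :: "'n::finite minkowski set"
  assumes M: "spacelike M" and M': "spacelike M'"
    and x: "local_param M W x" "u \<in> W" and x': "local_param M' W x'"
    and iso: "\<And>w. w \<in> W \<Longrightarrow> first_ff x' w = first_ff x w"
  shows "second_ff M x u $ i $ j * second_ff M x u $ l $ k - second_ff M x u $ l $ j * second_ff M x u $ i $ k =
    second_ff M' x' u $ i $ j * second_ff M' x' u $ l $ k - second_ff M' x' u $ l $ j * second_ff M' x' u $ i $ k"
proof -
  note W = local_paramD(1)[OF x(1)] and sm = local_paramD(2)[OF x(1)] and sm' = local_paramD(2)[OF x']
  have christoffel_eq: "mink (partial_deriv i (partial_deriv j x) w) (partial_deriv k x w) =
      mink (partial_deriv i (partial_deriv j x') w) (partial_deriv k x' w)" if w: "w \<in> W" for i j k w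
  proof -
    have "partial_deriv l (\<lambda>z. first_ff x z $ i $ j) w = partial_deriv l (\<lambda>z. first_ff x' z $ i $ j) w" for l i j
      by (rule partial_deriv_cong_open[OF W w]) (simp add: iso)
    then show ?thesis
      using mink_second_partial_deriv_first_ff[OF sm W w, of i j k] mink_second_partial_deriv_first_ff[OF sm' W w, of i j k]
      by simp
  qed
  have riemann_eq: "mink (partial_deriv i (partial_deriv j x) u) (partial_deriv l (partial_deriv k x) u)
      - mink (partial_deriv l (partial_deriv j x) u) (partial_deriv i (partial_deriv k x) u) =
    mink (partial_deriv i (partial_deriv j x') u) (partial_deriv l (partial_deriv k x') u)
      - mink (partial_deriv l (partial_deriv j x') u) (partial_deriv i (partial_deriv k x') u)"
    unfolding mink_second_derivatives[OF sm W x(2)] mink_second_derivatives[OF sm' W x(2)]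
    by (intro arg_cong2[where f = "(-)"] partial_deriv_cong_open[OF W x(2)] christoffel_eq)
  let ?G = "first_ff x u"
  obtain a where a1: "\<And>i j k. mink (partial_deriv i (partial_deriv j x) u) (partial_deriv k x u) = (?G *v a i j) $ k"
    and a2: "\<And>i j l k. mink (partial_deriv i (partial_deriv j x) u) (partial_deriv l (partial_deriv k x) u)
      = a i j \<bullet> (?G *v a l k) - second_ff M x u $ i $ j * second_ff M x u $ l $ k"
    using second_derivative_decomposition[OF M x] by blast
  obtain b where b1: "\<And>i j k. mink (partial_deriv i (partial_deriv j x') u) (partial_deriv k x' u) = (?G *v b i j) $ k"
    and b2: "\<And>i j l k. mink (partial_deriv i (partial_deriv j x') u) (partial_deriv l (partial_deriv k x') u)
      = b i j \<bullet> (?G *v b l k) - second_ff M' x' u $ i $ j * second_ff M' x' u $ l $ k"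
    using second_derivative_decomposition[OF M' x' x(2)] iso[OF x(2)] by metis
  have "a i j = b i j" for i j
  proof -
    have "?G *v a i j = ?G *v b i j"
      using christoffel_eq[OF x(2)] a1 b1 by (simp add: vec_eq_iff)
    then have "(a i j - b i j) \<bullet> (?G *v (a i j - b i j)) = 0"
      by (simp add: matrix_vector_mult_diff_distrib)
    then show ?thesis
      using first_ff_pos_def[OF M x] unfolding pos_def_def by (metis less_irrefl right_minus_eq)
  qed
  then show ?thesis using riemann_eq unfolding a2 b2 by simp
qed

section \<open>Transporting parametrizations along an isometry\<close>

lemma Ck_on_subset: "Ck_on k W f \<Longrightarrow> V \<subseteq> W \<Longrightarrow> Ck_on k V f"
  by (induction k arbitrary: f) (auto intro: continuous_on_subset)

text \<open>Isometries are formulated with charts of \<open>U\<close>, curvature with charts of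
  \<open>M\<close>; this and \<open>local_param_openin\<close> pass between the two.\<close>

lemma local_param_restrict:
  fixes M :: "'n::finite minkowski set"
  assumes x: "local_param M W x" and U: "openin (top_of_set M) U"
  shows "local_param U (W \<inter> x -` U) x"
proof -
  let ?V = "W \<inter> x -` U"
  have "openin (top_of_set W) ?V"
    using smooth_on_continuous[OF local_paramD(2)[OF x]] local_paramD(4)[OF x] U
    by (intro continuous_openin_preimage) auto
  then have "open ?V" using local_paramD(1)[OF x] openin_open_trans by blast
  moreover have "smooth_on ?V x"
    using local_paramD(2)[OF x] Ck_on_subset unfolding smooth_on_def by blast
  moreover have "openin (top_of_set U) (x ` ?V)"
  proof -
    have "x ` ?V = x ` W \<inter> U" by auto
    then have "openin (top_of_set M) (x ` ?V)" using local_paramD(3)[OF x] U by (simp add: openin_Int)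
    then show ?thesis
      by (rule openin_subset_trans[OF _ _ openin_imp_subset[OF U]]) auto
  qed
  moreover obtain g where "homeomorphism W (x ` W) x g" using local_paramD(5)[OF x] by blast
  then have "homeomorphism ?V (x ` ?V) x g"
    by (rule homeomorphism_of_subsets) auto
  ultimately show ?thesis
    using local_paramD(6)[OF x] unfolding local_param_def by blast
qed

lemma local_param_openin:
  assumes "local_param U W x" "openin (top_of_set M) U"
  shows "local_param M W x"
  using assms openin_trans unfolding local_param_def by blast

lemma ex_local_param_openin:
  assumes "smooth_hypersurface M" and U: "openin (top_of_set M) U" and "p \<in> U"
  obtains W x u where "local_param U W x" "u \<in> W" "x u = p"
proof -
  have "p \<in> M" using openin_imp_subset[OF U] \<open>p \<in> U\<close> by blast
  then obtain W x where x: "local_param M W x" "p \<in> x ` W"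
    using assms(1) unfolding smooth_hypersurface_def by blast
  then obtain u where "u \<in> W" "x u = p" by blast
  then show thesis
    using that[OF local_param_restrict[OF x(1) U], of u] \<open>p \<in> U\<close> by simp
qed

text \<open>On a chart image \<phi> is the smooth map \<open>\<phi> \<circ> x\<close> after the
  continuous chart inverse, and chart images are relatively open, so continuity there is continuity
  within \<open>U\<close>.\<close>

lemma smooth_map_continuous_on:
  fixes M :: "'n::finite minkowski set"
  assumes M: "smooth_hypersurface M" and U: "openin (top_of_set M) U" and \<phi>: "smooth_map U \<phi>"
  shows "continuous_on U \<phi>"
  unfolding continuous_on_eq_continuous_within
proof
  fix p assume "p \<in> U"
  then obtain W x u where x: "local_param U W x" "u \<in> W" "x u = p"
    using ex_local_param_openin[OF M U] by blast
  obtain g where g: "homeomorphism W (x ` W) x g" using local_paramD(5)[OF x(1)] by blast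
  have "smooth_on W (\<phi> \<circ> x)" using \<phi> x(1) unfolding smooth_map_def by blast
  then have "continuous_on (x ` W) (\<lambda>q. (\<phi> \<circ> x) (g q))"
    by (rule continuous_on_compose2[OF smooth_on_continuous])
      (use g in \<open>auto simp: homeomorphism_def\<close>)
  then have "continuous_on (x ` W) \<phi>"
    by (rule continuous_on_eq) (use g in \<open>auto simp: homeomorphism_def\<close>)
  then have "continuous (at p within x ` W) \<phi>"
    using x(2,3) unfolding continuous_on_eq_continuous_within by blast
  moreover obtain T where T: "open T" "x ` W = U \<inter> T"
    using local_paramD(3)[OF x(1)] unfolding openin_open by blast
  have "at p within x ` W = at p within U"
    by (rule at_within_nhd[of p T]) (use T x(2,3) in auto)
  ultimately show "continuous (at p within U) \<phi>" by simp
qed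

text \<open>The immersion property comes from the metric: a vector killed by the derivative of
  \<open>\<phi> \<circ> x\<close> would have length zero in the pullback metric, which is the
  positive definite metric of \<open>M\<close>.\<close>

lemma local_param_isometry:
  fixes M M' :: "'n::finite minkowski set"
  assumes M: "smooth_hypersurface M" "spacelike M" and M': "smooth_hypersurface M'"
    and U: "openin (top_of_set M) U" and U': "openin (top_of_set M') U'"
    and iso: "isometry_between U U' \<phi>" and x: "local_param U W x"
  shows "local_param M' W (\<phi> \<circ> x)"
proof -
  have bij: "bij_betw \<phi> U U'" and sm: "smooth_map U \<phi>" "smooth_map U' (inv_into U \<phi>)"
    and pull: "\<And>u. u \<in> W \<Longrightarrow> first_ff (\<phi> \<circ> x) u = first_ff x u"
    using iso x unfolding isometry_between_def by blast+
  have hom: "homeomorphism U U' \<phi> (inv_into U \<phi>)"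
    using bij smooth_map_continuous_on[OF M(1) U sm(1)] smooth_map_continuous_on[OF M' U' sm(2)]
    by (auto simp: homeomorphism_def bij_betw_def bij_betw_inv_into_left bij_betw_inv_into_right
        inv_into_f_f f_inv_into_f)
  obtain g where g: "homeomorphism W (x ` W) x g" using local_paramD(5)[OF x] by blast
  have img: "(\<phi> \<circ> x) ` W = \<phi> ` (x ` W)" by (simp add: image_comp)
  have "homeomorphism (x ` W) (\<phi> ` (x ` W)) \<phi> (inv_into U \<phi>)"
    using hom by (rule homeomorphism_of_subsets) (use local_paramD(4)[OF x] hom in \<open>auto simp: homeomorphism_def\<close>)
  then have "homeomorphism W ((\<phi> \<circ> x) ` W) (\<phi> \<circ> x) (g \<circ> inv_into U \<phi>)"
    unfolding img by (rule homeomorphism_compose[OF g])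
  moreover have "openin (top_of_set M') ((\<phi> \<circ> x) ` W)"
    unfolding img by (rule openin_trans[OF homeomorphism_imp_open_map[OF hom local_paramD(3)[OF x]] U'])
  moreover have smx: "smooth_on W (\<phi> \<circ> x)" using sm(1) x unfolding smooth_map_def by blast
  moreover have "inj (frechet_derivative (\<phi> \<circ> x) (at u))" if u: "u \<in> W" for u
  proof -
    have diff: "(\<phi> \<circ> x) differentiable (at u)" by (rule smooth_on_differentiable[OF smx u])
    note lin = linear_frechet_derivative[OF diff]
    have "a = 0" if "frechet_derivative (\<phi> \<circ> x) (at u) a = 0" for a
    proof -
      have "a \<bullet> (first_ff x u *v a) = 0"
        using first_ff_inner[OF diff, of a a] that by (simp add: pull[OF u] mink.zero_left)
      then show ?thesis
        using first_ff_pos_def[OF M(2) local_param_openin[OF x U] u] unfolding pos_def_def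
        by (metis less_irrefl)
    qed
    then show ?thesis using linear_injective_0[OF lin] by blast
  qed
  ultimately show ?thesis
    using local_paramD(1)[OF x] unfolding local_param_def by blast
qed

theorem lemma8p2:
  fixes M M' U U' :: "'n::finite minkowski set"
    and \<phi> :: "'n minkowski \<Rightarrow> 'n minkowski"
    and p :: "'n minkowski"
    and k :: nat
  assumes "CARD('n) \<ge> 3"
    and "smooth_hypersurface M" and "spacelike M" and "strictly_convex M"
    and "smooth_hypersurface M'" and "spacelike M'" and "strictly_convex M'"
    and "openin (top_of_set M) U" and "openin (top_of_set M') U'"
    and "isometry_between U U' \<phi>"
    and "p \<in> U" and "1 \<le> k" and "k \<le> CARD('n)"
  shows "sigma k (principal_curvatures M p) = sigma k (principal_curvatures M' (\<phi> p))"
proof -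
  obtain W x u where xU: "local_param U W x" and u: "u \<in> W" and p: "x u = p"
    using ex_local_param_openin[OF assms(2,8,11)] by blast
  have x: "local_param M W x" by (rule local_param_openin[OF xU assms(8)])
  \<comment> \<open>The transported chart keeps the domain \<open>W\<close>, so both hypersurfaces
    are compared through matrices at the same parameter \<open>u\<close>.\<close>
  have x': "local_param M' W (\<phi> \<circ> x)"
    by (rule local_param_isometry[OF assms(2,3,5,8-10) xU])
  have iso: "first_ff (\<phi> \<circ> x) w = first_ff x w" if "w \<in> W" for w
    using assms(10) xU that unfolding isometry_between_def by blast
  have "second_ff M x u = second_ff M' (\<phi> \<circ> x) u"
    by (rule pos_def_eq_if_minors_eq[OF assms(1)
          strictly_convex_second_ff_pos_def[OF assms(3,4) x u] second_ff_symmetric[OF assms(3) x u]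
          strictly_convex_second_ff_pos_def[OF assms(6,7) x' u] second_ff_symmetric[OF assms(6) x' u]
          second_ff_minors_intrinsic[OF assms(3,6) x u x' iso]])
  then have "principal_curvatures M p = principal_curvatures M' (\<phi> p)"
    using principal_curvatures_eq[OF assms(3) x u] principal_curvatures_eq[OF assms(6) x' u] iso[OF u] p
    by simp
  then show ?thesis by simp
qed

end
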